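(* Suppose the set of processes under consideration (the calculus) satisfies the aliased communication property. Then the function $$F=(\mathcal F_\sim\cup\mathrm{id}\cup\mathtt{refl}\cup\mathtt{sub}\cup\mathtt{res}\cup\mathtt{pcomp}\cup\mathtt{sum}\cup\mathtt{rep}\cup\mathtt{tau}\cup\mathtt{out}\cup\mathtt{inp})^\omega$$ is $\overline b$-sound: there exists an extensive function $f'$ such that for every relation $\mathcal R$, $\mathcal R\subseteq\overline b(F(\mathcal R))$ implies $f'(\mathcal R)\subseteq\overline b(f'(\mathcal R))$.
   Context: $\pi$-calculus processes: $P ::= !G \mid P|P \mid (\nu a)P \mid G$, $G ::= \mathbf 0 \mid \bar a\langle b\rangle.P \mid a(b).P \mid \tau.P \mid G+G$, up to $\alpha$-conversion; $P\sigma$ is capture-avoiding application of a name substitution. Visible actions $\alpha ::= \bar a\langle b\rangle \mid \bar a(b) \mid ab$ (output, bound output, early input); $\mu::=\alpha\mid\tau$. Early LTS: $a(b).P\xrightarrow{ac}P\{c/b\}$; $\bar a\langle b\rangle.P\xrightarrow{\bar a\langle b\rangle}P$; if $!G|G\xrightarrow{\mu}P'$ then $!G\xrightarrow{\mu}P'$; if $P\xrightarrow{\bar a\langle b\rangle}P'$, $b\ne a$ then $(\nu b)P\xrightarrow{\bar a(b)}P'$; if $G\xrightarrow\mu P'$ then $G+G'\xrightarrow\mu P'$ and $G'+G\xrightarrow\mu P'$; if $P\xrightarrow\mu P'$, $a\notin\mathrm n(\mu)$ then $(\nu a)P\xrightarrow\mu(\nu a)P'$; if $P\xrightarrow\mu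 P'$, $\mathrm{bn}(\mu)\cap\mathrm{fn}(Q)=\emptyset$ then $P|Q\xrightarrow\mu P'|Q$; if $P\xrightarrow{ab}P'$, $Q\xrightarrow{\bar a\langle b\rangle}Q'$ then $P|Q\xrightarrow\tau P'|Q'$; if $P\xrightarrow{ab}P'$, $Q\xrightarrow{\bar a(b)}Q'$, $b\notin\mathrm{fn}(P)$ then $P|Q\xrightarrow\tau(\nu b)(P'|Q')$; plus symmetric versions of the parallel rules. Aliased communication property: for every process $P$ considered, (i) if $P\xrightarrow{\bar a\langle b\rangle}\xrightarrow{cb}P'$ then $P\sigma\xrightarrow\tau P'\sigma$ for every substitution $\sigma$ with $a\sigma=c\sigma$; (ii) if $P\xrightarrow{\bar a(b)}\xrightarrow{cb}P'$ then $P\sigma\xrightarrow\tau(\nu b)P'\sigma$ for every such $\sigma$. $s(\mathcal R)=\{(P,Q)\mid$ for all $\mu,P'$, $P\xrightarrow\mu P'$ implies $\exists Q'$, $Q\xrightarrow\mu Q'$, $P'\mathcal RQ'\}$; $b(\mathcal R)=\{(P,Q)\mid (P,Q)\in s(\mathcal R), (Q,P)\in s(\mathcal R^{-1})\}$; $\overline b(\mathcal R)=\mathcal R\cap b(\mathcal R)$; $\sim$ (strong bisimilarity) is the largest $\mathcal R$ with $\mathcal R\subseteq b(\mathcal R)$. Up-to functions: $\mathcal F_\sim(\mathcal R)={\sim}\mathcal R{\sim}$ (relational composition); $\mathtt{refl}(\mathcal R)=\{(P,P)\}$; $\mathtt{sub}(\mathcal R)=\{(P\sigma,Q\sigma)\mid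 P\mathcal RQ\}$; $\mathtt{res}(\mathcal R)=\{((\nu\tilde a)P,(\nu\tilde a)Q)\mid P\mathcal RQ\}$; $\mathtt{pcomp}(\mathcal R)=\{(P|P',Q|Q')\mid P\mathcal RQ, P'\mathcal RQ'\}$; $\mathtt{sum}(\mathcal R)=\{(G_1+G_2,G_1'+G_2')\mid G_1\mathcal RG_1', G_2\mathcal RG_2'\}$; $\mathtt{rep}(\mathcal R)=\{(!G,!G')\mid G\mathcal RG'\}$; $\mathtt{tau}(\mathcal R)=\{(\tau.P,\tau.Q)\mid P\mathcal RQ\}$; $\mathtt{out}(\mathcal R)=\{(\bar a\langle b\rangle.P,\bar a\langle b\rangle.Q)\mid P\mathcal RQ\}$; $\mathtt{inp}(\mathcal R)=\{(a(b).P,a(b).Q)\mid P\mathcal RQ\}$. Unions of functions are pointwise, $f^0=\mathrm{id}$, $f^{n+1}=f\circ f^n$, $f^\omega(\mathcal R)=\bigcup_n f^n(\mathcal R)$; $f'$ extensive means $\mathcal R\subseteq f'(\mathcal R)$ for all $\mathcal R$.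
   Formalization: In s(R), Q need only match a bound output ā(b) of P when b is not free in Q (usual convention; without it the claim is false); in (ii), b is fresh for σ; relations and each step of F are restricted to the calculus, which is closed under transitions and substitutions. *)

theory Defs
  imports Main
begin

section \<open>Processes up to alpha-conversion\<close>

text \<open>
  Names are natural numbers; only their infinity matters.  Alpha-equivalence classes of
  processes are represented by de Bruijn terms in which the free names play the role of the
  free indices: under \<open>k\<close> binders, index \<open>i < k\<close> refers to a binder and index \<open>i + k\<close> to the
  free name \<open>i\<close>.  The constructors \<open>NewB\<close> and \<open>InB\<close> bind index 0 of their continuation and are
  only used to define the named binders \<open>res a P\<close> for $(\nu a)P$ and \<open>inp a b P\<close> for $a(b).P$
  below.  Everything afterwards is phrased with the named binders.
  The sort \<open>gproc\<close> is the grammar of guarded sums $G$, and \<open>Gd\<close> is the inclusion of $G$ into $P$.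
\<close>

type_synonym name = nat

datatype proc =
    Bang gproc
  | Par proc proc
  | NewB proc
  | Gd gproc
and gproc =
    Zero
  | Out name name proc
  | InB name proc
  | Tau proc
  | Plus gproc gproc

definition lift :: "(name \<Rightarrow> name) \<Rightarrow> name \<Rightarrow> name" where
  "lift \<sigma> x = (case x of 0 \<Rightarrow> 0 | Suc y \<Rightarrow> Suc (\<sigma> y))"

text \<open>Capture-avoiding application $P\sigma$ of a name substitution.\<close>

primrec subst :: "(name \<Rightarrow> name) \<Rightarrow> proc \<Rightarrow> proc"
  and substG :: "(name \<Rightarrow> name) \<Rightarrow> gproc \<Rightarrow> gproc" where
  "subst \<sigma> (Bang G) = Bang (substG \<sigma> G)"
| "subst \<sigma> (Par P Q) = Par (subst \<sigma> P) (subst \<sigma> Q)"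
| "subst \<sigma> (NewB P) = NewB (subst (lift \<sigma>) P)"
| "subst \<sigma> (Gd G) = Gd (substG \<sigma> G)"
| "substG \<sigma> Zero = Zero"
| "substG \<sigma> (Out a b P) = Out (\<sigma> a) (\<sigma> b) (subst \<sigma> P)"
| "substG \<sigma> (InB a P) = InB (\<sigma> a) (subst (lift \<sigma>) P)"
| "substG \<sigma> (Tau P) = Tau (subst \<sigma> P)"
| "substG \<sigma> (Plus G H) = Plus (substG \<sigma> G) (substG \<sigma> H)"

primrec fn :: "proc \<Rightarrow> name set"
  and fnG :: "gproc \<Rightarrow> name set" where
  "fn (Bang G) = fnG G"
| "fn (Par P Q) = fn P \<union> fn Q"
| "fn (NewB P) = {x. Suc x \<in> fn P}"
| "fn (Gd G) = fnG G"
| "fnG Zero = {}"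
| "fnG (Out a b P) = {a, b} \<union> fn P"
| "fnG (InB a P) = {a} \<union> {x. Suc x \<in> fn P}"
| "fnG (Tau P) = fn P"
| "fnG (Plus G H) = fnG G \<union> fnG H"

text \<open>\<open>close a P\<close> turns the free name \<open>a\<close> of \<open>P\<close> into index 0.\<close>

definition close :: "name \<Rightarrow> proc \<Rightarrow> proc" where
  "close a P = subst (\<lambda>x. if x = a then 0 else Suc x) P"

definition res :: "name \<Rightarrow> proc \<Rightarrow> proc" where
  "res a P = NewB (close a P)"

definition inp :: "name \<Rightarrow> name \<Rightarrow> proc \<Rightarrow> gproc" where
  "inp a b P = InB a (close b P)"

subsection \<open>Adequacy of the named binders\<close>

text \<open>
  The lemmas of this subsection validate the encoding: equality of named binders is
  alpha-conversion, every process is built with named binders whose bound name can be chosen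
  fresh, and \<open>fn\<close> and \<open>subst\<close> satisfy the usual equations.
\<close>

lemma lift_simps [simp]: "lift \<sigma> 0 = 0" "lift \<sigma> (Suc x) = Suc (\<sigma> x)"
  by (simp_all add: lift_def)

lemma lift_id: "lift id = id"
  by (rule ext) (simp add: lift_def split: nat.split)

lemma lift_comp: "lift \<sigma> \<circ> lift \<tau> = lift (\<sigma> \<circ> \<tau>)"
  by (rule ext) (simp add: lift_def split: nat.split)

lemma finite_Suc_vimage: "finite A \<Longrightarrow> finite {x. Suc x \<in> A}"
  using finite_vimageI[of A Suc] by (simp add: vimage_def)

lemma finite_fn: "finite (fn P)" and finite_fnG: "finite (fnG G)"
  by (induction P and G) (auto intro: finite_Suc_vimage)

lemma subst_cong: "(\<And>x. x \<in> fn P \<Longrightarrow> \<sigma> x = \<tau> x) \<Longrightarrow> subst \<sigma> P = subst \<tau> P"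
  and substG_cong: "(\<And>x. x \<in> fnG G \<Longrightarrow> \<sigma> x = \<tau> x) \<Longrightarrow> substG \<sigma> G = substG \<tau> G"
proof (induction P and G arbitrary: \<sigma> \<tau> and \<sigma> \<tau>)
  case (NewB P)
  have "subst (lift \<sigma>) P = subst (lift \<tau>) P"
  proof (rule NewB.IH)
    fix x assume "x \<in> fn P"
    then show "lift \<sigma> x = lift \<tau> x" by (cases x) (simp_all add: NewB.prems)
  qed
  then show ?case by simp
next
  case (InB a P)
  have "subst (lift \<sigma>) P = subst (lift \<tau>) P"
  proof (rule InB.IH)
    fix x assume "x \<in> fn P"
    then show "lift \<sigma> x = lift \<tau> x" by (cases x) (simp_all add: InB.prems)
  qed
  then show ?case by (simp add: InB.prems)
next
  case (Out a b P)
  have "subst \<sigma> P = subst \<tau> P" by (rule Out.IH) (simp add: Out.prems)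
  then show ?case by (simp add: Out.prems)
next
  case (Par P Q)
  have "subst \<sigma> P = subst \<tau> P" "subst \<sigma> Q = subst \<tau> Q"
    by (rule Par.IH(1), simp add: Par.prems) (rule Par.IH(2), simp add: Par.prems)
  then show ?case by simp
next
  case (Plus P Q)
  have "substG \<sigma> P = substG \<tau> P" "substG \<sigma> Q = substG \<tau> Q"
    by (rule Plus.IH(1), simp add: Plus.prems) (rule Plus.IH(2), simp add: Plus.prems)
  then show ?case by simp
next
  case (Tau P)
  have "subst \<sigma> P = subst \<tau> P" by (rule Tau.IH) (simp add: Tau.prems)
  then show ?case by simp
next
  case (Bang G)
  have "substG \<sigma> G = substG \<tau> G" by (rule Bang.IH) (simp add: Bang.prems)
  then show ?case by simp
next
  case (Gd G)
  have "substG \<sigma> G = substG \<tau> G" by (rule Gd.IH) (simp add: Gd.prems)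
  then show ?case by simp
qed simp

lemma subst_id: "subst id P = P" and substG_id: "substG id G = G"
  by (induction P and G) (simp_all add: lift_id [unfolded id_def] id_def)

lemma subst_subst: "subst \<sigma> (subst \<tau> P) = subst (\<sigma> \<circ> \<tau>) P"
  and substG_substG: "substG \<sigma> (substG \<tau> G) = substG (\<sigma> \<circ> \<tau>) G"
  by (induction P and G arbitrary: \<sigma> \<tau> and \<sigma> \<tau>) (simp_all add: lift_comp)

lemma lift_Suc_image: "{x. Suc x \<in> lift \<sigma> ` A} = \<sigma> ` {x. Suc x \<in> A}"
proof (intro equalityI subsetI)
  fix x assume "x \<in> {x. Suc x \<in> lift \<sigma> ` A}"
  then obtain y where "y \<in> A" "Suc x = lift \<sigma> y" by auto
  then show "x \<in> \<sigma> ` {x. Suc x \<in> A}" by (cases y) auto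
next
  fix x assume "x \<in> \<sigma> ` {x. Suc x \<in> A}"
  then obtain y where "Suc y \<in> A" "x = \<sigma> y" by auto
  then have "Suc x = lift \<sigma> (Suc y)" by simp
  then show "x \<in> {x. Suc x \<in> lift \<sigma> ` A}" using \<open>Suc y \<in> A\<close> by blast
qed

lemma fn_subst: "fn (subst \<sigma> P) = \<sigma> ` fn P" and fnG_substG: "fnG (substG \<sigma> G) = \<sigma> ` fnG G"
  by (induction P and G arbitrary: \<sigma> and \<sigma>) (simp_all add: lift_Suc_image image_Un)

lemma Suc_fn_close: "{x. Suc x \<in> fn (close a P)} = fn P - {a}"
  by (auto simp: close_def fn_subst image_iff)

lemma fn_res: "fn (res a P) = fn P - {a}"
  by (simp add: res_def Suc_fn_close)

lemma fnG_inp: "fnG (inp a b P) = {a} \<union> (fn P - {b})"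
  by (simp add: inp_def Suc_fn_close)

lemma subst_close:
  assumes "\<sigma> a = a" "\<And>x. x \<in> fn P - {a} \<Longrightarrow> \<sigma> x \<noteq> a"
  shows "subst (lift \<sigma>) (close a P) = close a (subst \<sigma> P)"
  unfolding close_def subst_subst by (rule subst_cong) (use assms in auto)

lemma subst_res:
  assumes "\<sigma> a = a" "\<And>x. x \<in> fn P - {a} \<Longrightarrow> \<sigma> x \<noteq> a"
  shows "subst \<sigma> (res a P) = res a (subst \<sigma> P)"
  using subst_close[of \<sigma> a P] assms by (simp add: res_def)

lemma substG_inp:
  assumes "\<sigma> b = b" "\<And>x. x \<in> fn P - {b} \<Longrightarrow> \<sigma> x \<noteq> b"
  shows "substG \<sigma> (inp a b P) = inp (\<sigma> a) b (subst \<sigma> P)"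
  using subst_close[of \<sigma> b P] assms by (simp add: inp_def)

lemma close_eq_iff: "close a P = close b Q \<longleftrightarrow> b \<notin> fn P - {a} \<and> Q = subst (id(a := b)) P"
proof
  assume eq: "close a P = close b Q"
  from arg_cong[OF eq, of "\<lambda>R. {x. Suc x \<in> fn R}"] have fresh: "b \<notin> fn P - {a}"
    by (simp add: Suc_fn_close)
  let ?open = "\<lambda>x. case x of 0 \<Rightarrow> b | Suc y \<Rightarrow> y"
  have "subst ?open (close b Q) = subst id Q"
    unfolding close_def subst_subst by (rule subst_cong) auto
  moreover have "subst ?open (close a P) = subst (id(a := b)) P"
    unfolding close_def subst_subst by (rule subst_cong) auto
  ultimately show "b \<notin> fn P - {a} \<and> Q = subst (id(a := b)) P"
    using eq fresh by (simp add: subst_id)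
next
  assume *: "b \<notin> fn P - {a} \<and> Q = subst (id(a := b)) P"
  then have "close b Q = close b (subst (id(a := b)) P)" by simp
  also have "\<dots> = close a P"
    unfolding close_def subst_subst by (rule subst_cong) (use * in auto)
  finally show "close a P = close b Q" by simp
qed

lemma res_eq_iff: "res a P = res b Q \<longleftrightarrow> b \<notin> fn P - {a} \<and> Q = subst (id(a := b)) P"
  by (simp add: res_def close_eq_iff)

lemma inp_eq_iff:
  "inp c a P = inp d b Q \<longleftrightarrow> c = d \<and> b \<notin> fn P - {a} \<and> Q = subst (id(a := b)) P"
  by (simp add: inp_def close_eq_iff)

lemma close_surj:
  assumes "finite A"
  obtains a P where "a \<notin> A" "Q = close a P"
proof -
  have "finite (A \<union> {x. Suc x \<in> fn Q})"
    using assms finite_Suc_vimage[OF finite_fn] by simp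
  then obtain a where a: "a \<notin> A" "Suc a \<notin> fn Q"
    using ex_new_if_finite[OF infinite_UNIV_nat] by blast
  let ?P = "subst (\<lambda>x. case x of 0 \<Rightarrow> a | Suc y \<Rightarrow> y) Q"
  have "close a ?P = subst id Q"
    unfolding close_def subst_subst
    by (rule subst_cong) (use a(2) in \<open>auto split: nat.split\<close>)
  then show thesis using that[of a ?P] a by (simp add: subst_id)
qed

lemma proc_cases:
  assumes "finite A"
  obtains (Bang) G where "P = Bang G"
  | (Par) Q R where "P = Par Q R"
  | (res) a Q where "a \<notin> A" "P = res a Q"
  | (Gd) G where "P = Gd G"
proof (cases P)
  case (NewB P')
  obtain a Q where "a \<notin> A" "P' = close a Q" using close_surj[OF assms] .
  with NewB that(3) show thesis by (simp add: res_def)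
qed (use that in blast)+

lemma gproc_cases:
  assumes "finite A"
  obtains (Zero) "G = Zero"
  | (Out) a b Q where "G = Out a b Q"
  | (inp) a b Q where "b \<notin> A" "G = inp a b Q"
  | (Tau) Q where "G = Tau Q"
  | (Plus) H K where "G = Plus H K"
proof (cases G)
  case (InB a P')
  obtain b Q where "b \<notin> A" "P' = close b Q" using close_surj[OF assms] .
  with InB that(3) show thesis by (simp add: inp_def)
qed (use that in blast)+

section \<open>Early labelled transition system\<close>

text \<open>\<open>AOut a b\<close>, \<open>ABOut a b\<close>, \<open>AIn a b\<close> stand for $\bar a\langle b\rangle$, $\bar a(b)$, $ab$.\<close>

datatype act = AOut name name | ABOut name name | AIn name name | ATau

fun names :: "act \<Rightarrow> name set" where
  "names (AOut a b) = {a, b}"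
| "names (ABOut a b) = {a, b}"
| "names (AIn a b) = {a, b}"
| "names ATau = {}"

fun bn :: "act \<Rightarrow> name set" where
  "bn (ABOut a b) = {b}"
| "bn _ = {}"

inductive lts :: "proc \<Rightarrow> act \<Rightarrow> proc \<Rightarrow> bool"  ("_ \<longmapsto>[_] _" [51, 0, 51] 50) where
  In: "Gd (inp a b P) \<longmapsto>[AIn a c] subst (id(b := c)) P"
| Out: "Gd (Out a b P) \<longmapsto>[AOut a b] P"
| Tau: "Gd (Tau P) \<longmapsto>[ATau] P"
| Rep: "Par (Bang G) (Gd G) \<longmapsto>[\<mu>] P' \<Longrightarrow> Bang G \<longmapsto>[\<mu>] P'"
| Open: "P \<longmapsto>[AOut a b] P' \<Longrightarrow> b \<noteq> a \<Longrightarrow> res b P \<longmapsto>[ABOut a b] P'"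
| SumL: "Gd G \<longmapsto>[\<mu>] P' \<Longrightarrow> Gd (Plus G G') \<longmapsto>[\<mu>] P'"
| SumR: "Gd G \<longmapsto>[\<mu>] P' \<Longrightarrow> Gd (Plus G' G) \<longmapsto>[\<mu>] P'"
| Res: "P \<longmapsto>[\<mu>] P' \<Longrightarrow> a \<notin> names \<mu> \<Longrightarrow> res a P \<longmapsto>[\<mu>] res a P'"
| ParL: "P \<longmapsto>[\<mu>] P' \<Longrightarrow> bn \<mu> \<inter> fn Q = {} \<Longrightarrow> Par P Q \<longmapsto>[\<mu>] Par P' Q"
| ParR: "Q \<longmapsto>[\<mu>] Q' \<Longrightarrow> bn \<mu> \<inter> fn P = {} \<Longrightarrow> Par P Q \<longmapsto>[\<mu>] Par P Q'"
| CommL: "P \<longmapsto>[AIn a b] P' \<Longrightarrow> Q \<longmapsto>[AOut a b] Q' \<Longrightarrow> Par P Q \<longmapsto>[ATau] Par P' Q'"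
| CommR: "P \<longmapsto>[AOut a b] P' \<Longrightarrow> Q \<longmapsto>[AIn a b] Q' \<Longrightarrow> Par P Q \<longmapsto>[ATau] Par P' Q'"
| CloseL: "P \<longmapsto>[AIn a b] P' \<Longrightarrow> Q \<longmapsto>[ABOut a b] Q' \<Longrightarrow> b \<notin> fn P \<Longrightarrow>
    Par P Q \<longmapsto>[ATau] res b (Par P' Q')"
| CloseR: "P \<longmapsto>[ABOut a b] P' \<Longrightarrow> Q \<longmapsto>[AIn a b] Q' \<Longrightarrow> b \<notin> fn Q \<Longrightarrow>
    Par P Q \<longmapsto>[ATau] res b (Par P' Q')"

section \<open>Calculi and the aliased communication property\<close>

text \<open>
  The set \<open>C\<close> of processes under consideration.  It must be the state space of a transition
  system and carry the action of substitutions; no closure under the operators of the syntax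
  (nor under subterms) is required, since typical calculi with aliased communication, such as
  the asynchronous one, are not closed under output prefix.
\<close>

definition calculus :: "proc set \<Rightarrow> bool" where
  "calculus C \<longleftrightarrow>
    (\<forall>P\<in>C. \<forall>\<mu> P'. P \<longmapsto>[\<mu>] P' \<longrightarrow> P' \<in> C) \<and>
    (\<forall>P\<in>C. \<forall>\<sigma>. subst \<sigma> P \<in> C)"

text \<open>
  In the second clause the name \<open>b\<close> is bound in the conclusion, so it is taken fresh for \<open>\<sigma>\<close>
  (\<open>\<sigma>\<close> fixes \<open>b\<close> and maps no other name to it).  Without this convention the clause would
  fail for every process such as $(\nu b)(\bar a\langle b\rangle.0 \mid b(x).0)$, with \<open>c = b\<close> and
  \<open>\<sigma>\<close> replacing \<open>a\<close> by \<open>b\<close>.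
\<close>

definition aliased_communication :: "proc set \<Rightarrow> bool" where
  "aliased_communication C \<longleftrightarrow>
    (\<forall>P\<in>C. \<forall>a b c P1 P' \<sigma>.
      P \<longmapsto>[AOut a b] P1 \<longrightarrow> P1 \<longmapsto>[AIn c b] P' \<longrightarrow> \<sigma> a = \<sigma> c \<longrightarrow>
      subst \<sigma> P \<longmapsto>[ATau] subst \<sigma> P') \<and>
    (\<forall>P\<in>C. \<forall>a b c P1 P' \<sigma>.
      P \<longmapsto>[ABOut a b] P1 \<longrightarrow> P1 \<longmapsto>[AIn c b] P' \<longrightarrow> \<sigma> a = \<sigma> c \<longrightarrow>
      \<sigma> b = b \<longrightarrow> (\<forall>x. \<sigma> x = b \<longrightarrow> x = b) \<longrightarrow>
      subst \<sigma> P \<longmapsto>[ATau] res b (subst \<sigma> P'))"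

section \<open>Bisimilarity and up-to functions\<close>

text \<open>
  Relations range over the processes of \<open>C\<close>.  The bound name of a bound output is, by the usual
  convention, fresh for both processes.  This cannot be left out: a process in which \<open>b\<close> is free
  has no transition labelled \<open>ABOut a b\<close>, so bisimilarity would otherwise observe free names
  that take part in no transition, and would not be preserved by parallel composition.
\<close>

definition sim :: "proc set \<Rightarrow> proc rel \<Rightarrow> proc rel" where
  "sim C R = {(P, Q). P \<in> C \<and> Q \<in> C \<and>
    (\<forall>\<mu> P'. P \<longmapsto>[\<mu>] P' \<longrightarrow> bn \<mu> \<inter> fn Q = {} \<longrightarrow> (\<exists>Q'. Q \<longmapsto>[\<mu>] Q' \<and> (P', Q') \<in> R))}"

definition bis :: "proc set \<Rightarrow> proc rel \<Rightarrow> proc rel" where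
  "bis C R = {(P, Q). (P, Q) \<in> sim C R \<and> (Q, P) \<in> sim C (R\<inverse>)}"

definition bbar :: "proc set \<Rightarrow> proc rel \<Rightarrow> proc rel" where
  "bbar C R = R \<inter> bis C R"

definition bisimilarity :: "proc set \<Rightarrow> proc rel" where
  "bisimilarity C = \<Union>{R. R \<subseteq> C \<times> C \<and> R \<subseteq> bis C R}"

definition up_bisim :: "proc set \<Rightarrow> proc rel \<Rightarrow> proc rel" where
  "up_bisim C R = bisimilarity C O R O bisimilarity C"

definition up_refl :: "proc rel \<Rightarrow> proc rel" where
  "up_refl R = {(P, P) | P. True}"

definition up_sub :: "proc rel \<Rightarrow> proc rel" where
  "up_sub R = {(subst \<sigma> P, subst \<sigma> Q) | \<sigma> P Q. (P, Q) \<in> R}"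

definition up_res :: "proc rel \<Rightarrow> proc rel" where
  "up_res R = {(foldr res as P, foldr res as Q) | as P Q. (P, Q) \<in> R}"

definition up_pcomp :: "proc rel \<Rightarrow> proc rel" where
  "up_pcomp R = {(Par P P', Par Q Q') | P P' Q Q'. (P, Q) \<in> R \<and> (P', Q') \<in> R}"

definition up_sum :: "proc rel \<Rightarrow> proc rel" where
  "up_sum R = {(Gd (Plus G1 G2), Gd (Plus G1' G2')) | G1 G2 G1' G2'.
    (Gd G1, Gd G1') \<in> R \<and> (Gd G2, Gd G2') \<in> R}"

definition up_rep :: "proc rel \<Rightarrow> proc rel" where
  "up_rep R = {(Bang G, Bang G') | G G'. (Gd G, Gd G') \<in> R}"

definition up_tau :: "proc rel \<Rightarrow> proc rel" where
  "up_tau R = {(Gd (Tau P), Gd (Tau Q)) | P Q. (P, Q) \<in> R}"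

definition up_out :: "proc rel \<Rightarrow> proc rel" where
  "up_out R = {(Gd (Out a b P), Gd (Out a b Q)) | a b P Q. (P, Q) \<in> R}"

definition up_inp :: "proc rel \<Rightarrow> proc rel" where
  "up_inp R = {(Gd (inp a b P), Gd (inp a b Q)) | a b P Q. (P, Q) \<in> R}"

text \<open>
  As \<open>C\<close> need not be closed under the operators, the union is restricted to \<open>C\<close> to be a function on
  relations over \<open>C\<close>.
\<close>

definition up_step :: "proc set \<Rightarrow> proc rel \<Rightarrow> proc rel" where
  "up_step C R =
    (up_bisim C R \<union> R \<union> up_refl R \<union> up_sub R \<union> up_res R \<union> up_pcomp R \<union> up_sum R \<union> up_rep R
      \<union> up_tau R \<union> up_out R \<union> up_inp R) \<inter> (C \<times> C)"

definition omega :: "('a set \<Rightarrow> 'a set) \<Rightarrow> 'a set \<Rightarrow> 'a set" where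
  "omega f R = (\<Union>n. (f ^^ n) R)"

definition sound_on :: "'a set \<Rightarrow> ('a rel \<Rightarrow> 'a rel) \<Rightarrow> ('a rel \<Rightarrow> 'a rel) \<Rightarrow> bool" where
  "sound_on C g f \<longleftrightarrow> (\<exists>f'.
    (\<forall>R. R \<subseteq> C \<times> C \<longrightarrow> R \<subseteq> f' R \<and> f' R \<subseteq> C \<times> C) \<and>
    (\<forall>R. R \<subseteq> C \<times> C \<longrightarrow> R \<subseteq> g (f R) \<longrightarrow> f' R \<subseteq> g (f' R)))"

end

theory Submission
  imports Defs
begin

text \<open>
  Let \<open>S\<close> be the symmetric closure of \<open>R\<close> together with bisimilarity, and close \<open>S\<close> under
  substitutions, all operators, transitivity and the structural laws for restriction and parallel
  composition.  If \<open>R\<close> progresses to \<open>F(R)\<close>, this congruence is a bisimulation.  Operators other than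
  substitution are routine.  A visible transition of $P\sigma$ comes from a visible transition of $P$,
  so a first induction shows that the congruence matches visible transitions.  A silent transition
  of $P\sigma$ that is not a silent transition of $P$ comes from an output of $P$ followed by an input,
  on channels identified by $\sigma$.  Both steps are visible, hence matched by $Q$ according to the
  first induction, and aliased communication turns them back into a silent transition of $Q\sigma$; a
  second induction then matches silent transitions.
\<close>

section \<open>A late transition system on de Bruijn terms\<close>

text \<open>The two inductions cannot be merged. Once \<open>Q\<close> has matched the output, the
  residuals are related by \<open>congr S\<close> through a derivation of unknown size, so the input
  that follows must already be matched for arbitrary pairs of \<open>congr S\<close>. Visible
  matching can be had beforehand because visible steps of a compound come only from visible steps of
  its components. Contexts built by the closure may lie outside \<open>C\<close>, where nothing is
  known about aliased communication. This is harmless because substitutions occur only at the leaves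
  of \<open>congr\<close>: the property is applied to the second component of a pair in
  \<open>S\<close> and to nothing else. The structural laws are those that carry an extruded
  restriction to the top: exchange with other restrictions, and scope extrusion over a parallel
  component on either side. Having transitivity as a rule absorbs both these laws and composition
  with bisimilarity. Late transitions on de Bruijn terms replace the freshness conditions on
  extruded names by index shifts.\<close>

datatype lab = LOut name name | LBOut name | LIn name | LTau

fun binds :: "lab \<Rightarrow> bool" where
  "binds (LBOut a) = True"
| "binds (LIn a) = True"
| "binds _ = False"

fun lmap :: "(name \<Rightarrow> name) \<Rightarrow> lab \<Rightarrow> lab" where
  "lmap \<sigma> (LOut a b) = LOut (\<sigma> a) (\<sigma> b)"
| "lmap \<sigma> (LBOut a) = LBOut (\<sigma> a)"
| "lmap \<sigma> (LIn a) = LIn (\<sigma> a)"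
| "lmap \<sigma> LTau = LTau"

fun lnames :: "lab \<Rightarrow> name set" where
  "lnames (LOut a b) = {a, b}"
| "lnames (LBOut a) = {a}"
| "lnames (LIn a) = {a}"
| "lnames LTau = {}"

text \<open>How \<open>\<sigma>\<close> acts on the target of an \<open>l\<close>-transition: a
  binding label adds an index 0, which \<open>\<sigma>\<close> must leave alone.\<close>

definition under :: "lab \<Rightarrow> (name \<Rightarrow> name) \<Rightarrow> name \<Rightarrow> name" where
  "under l \<sigma> = (if binds l then lift \<sigma> else \<sigma>)"

definition weak :: "lab \<Rightarrow> proc \<Rightarrow> proc" where
  "weak l P = (if binds l then subst Suc P else P)"

definition flip :: "name \<Rightarrow> name" where
  "flip x = (case x of 0 \<Rightarrow> Suc 0 | Suc y \<Rightarrow> (case y of 0 \<Rightarrow> 0 | Suc z \<Rightarrow> Suc (Suc z)))"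

text \<open>Below a restriction, the target of a binding transition has the name of the label at
  index 0 and the restricted name at index 1. \<open>tr_New\<close> puts the restriction back
  inside, which needs the opposite order.\<close>

definition exch :: "lab \<Rightarrow> proc \<Rightarrow> proc" where
  "exch l P = (if binds l then subst flip P else P)"

definition inst :: "name \<Rightarrow> name \<Rightarrow> name" where
  "inst c x = (case x of 0 \<Rightarrow> c | Suc y \<Rightarrow> y)"

text \<open>Index 0 of the target of an \<open>LIn\<close> or \<open>LBOut\<close> transition is the received or extruded name, so
  that rule \<open>tr_CloseL\<close> just puts both targets below one \<open>NewB\<close>.  As the relations below are closed
  under substitution, early and late matching of inputs coincide (instantiate by a fresh name).\<close>

inductive tr :: "proc \<Rightarrow> lab \<Rightarrow> proc \<Rightarrow> bool" where
  tr_In: "tr (Gd (InB a P)) (LIn a) P"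
| tr_Out: "tr (Gd (Out a b P)) (LOut a b) P"
| tr_Tau: "tr (Gd (Tau P)) LTau P"
| tr_Rep: "tr (Par (Bang G) (Gd G)) l P' \<Longrightarrow> tr (Bang G) l P'"
| tr_SumL: "tr (Gd G) l P' \<Longrightarrow> tr (Gd (Plus G H)) l P'"
| tr_SumR: "tr (Gd G) l P' \<Longrightarrow> tr (Gd (Plus H G)) l P'"
| tr_Open: "tr P (LOut (Suc a) 0) P' \<Longrightarrow> tr (NewB P) (LBOut a) P'"
| tr_New: "tr P (lmap Suc l) P' \<Longrightarrow> tr (NewB P) l (NewB (exch l P'))"
| tr_ParL: "tr P l P' \<Longrightarrow> tr (Par P Q) l (Par P' (weak l Q))"
| tr_ParR: "tr Q l Q' \<Longrightarrow> tr (Par P Q) l (Par (weak l P) Q')"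
| tr_CommL: "tr P (LIn a) P' \<Longrightarrow> tr Q (LOut a b) Q' \<Longrightarrow>
    tr (Par P Q) LTau (Par (subst (inst b) P') Q')"
| tr_CommR: "tr P (LOut a b) P' \<Longrightarrow> tr Q (LIn a) Q' \<Longrightarrow>
    tr (Par P Q) LTau (Par P' (subst (inst b) Q'))"
| tr_CloseL: "tr P (LIn a) P' \<Longrightarrow> tr Q (LBOut a) Q' \<Longrightarrow> tr (Par P Q) LTau (NewB (Par P' Q'))"
| tr_CloseR: "tr P (LBOut a) P' \<Longrightarrow> tr Q (LIn a) Q' \<Longrightarrow> tr (Par P Q) LTau (NewB (Par P' Q'))"

inductive_cases tr_NewE [consumes 1]: "tr (NewB P) l P'"
inductive_cases tr_ParE [consumes 1]: "tr (Par P Q) l P'"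
inductive_cases tr_InE [consumes 1]: "tr (Gd (InB a P)) l P'"
inductive_cases tr_OutE [consumes 1]: "tr (Gd (Out a b P)) l P'"
inductive_cases tr_TauE [consumes 1]: "tr (Gd (Tau P)) l P'"
inductive_cases tr_PlusE [consumes 1]: "tr (Gd (Plus G H)) l P'"

lemma under_simps [simp]:
  "under (LOut a b) \<sigma> = \<sigma>" "under LTau \<sigma> = \<sigma>"
  "under (LBOut a) \<sigma> = lift \<sigma>" "under (LIn a) \<sigma> = lift \<sigma>"
  by (simp_all add: under_def)

lemma weak_simps [simp]:
  "weak (LOut a b) P = P" "weak LTau P = P"
  "weak (LBOut a) P = subst Suc P" "weak (LIn a) P = subst Suc P"
  by (simp_all add: weak_def)

lemma exch_simps [simp]:
  "exch (LOut a b) P = P" "exch LTau P = P"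
  "exch (LBOut a) P = subst flip P" "exch (LIn a) P = subst flip P"
  by (simp_all add: exch_def)

lemma inst_simps [simp]: "inst c 0 = c" "inst c (Suc y) = y"
  by (simp_all add: inst_def)

lemma flip_simps [simp]: "flip 0 = Suc 0" "flip (Suc 0) = 0" "flip (Suc (Suc x)) = Suc (Suc x)"
  by (simp_all add: flip_def)

lemma binds_lmap [simp]: "binds (lmap \<sigma> l) = binds l"
  by (cases l) simp_all

lemma under_lmap [simp]: "under (lmap \<sigma> l) \<tau> = under l \<tau>"
  by (simp add: under_def)

lemma lmap_lmap: "lmap \<sigma> (lmap \<tau> l) = lmap (\<sigma> \<circ> \<tau>) l"
  by (cases l) simp_all

lemma lnames_lmap: "lnames (lmap \<sigma> l) = \<sigma> ` lnames l"
  by (cases l) simp_all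

lemma lmap_eq_LTau_iff [simp]: "lmap \<sigma> l = LTau \<longleftrightarrow> l = LTau" "LTau = lmap \<sigma> l \<longleftrightarrow> l = LTau"
  by (cases l; simp)+

lemma weak_lmap [simp]: "weak (lmap \<sigma> l) P = weak l P"
  by (simp add: weak_def)

lemma subst_ident: "(\<And>x. x \<in> fn P \<Longrightarrow> \<sigma> x = x) \<Longrightarrow> subst \<sigma> P = P"
  using subst_cong[of P \<sigma> id] by (simp add: subst_id)

lemma subst_same [simp]: "subst (\<lambda>x. x) P = P"
  by (simp add: subst_ident)

lemma nat_cases3: "(x = 0 \<Longrightarrow> thesis) \<Longrightarrow> (x = Suc 0 \<Longrightarrow> thesis) \<Longrightarrow> (\<And>y. x = Suc (Suc y) \<Longrightarrow> thesis)
    \<Longrightarrow> thesis"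
  by (metis not0_implies_Suc)

lemma subst_eqI:
  assumes "\<sigma> 0 = \<tau> 0" "\<sigma> (Suc 0) = \<tau> (Suc 0)" "\<And>y. \<sigma> (Suc (Suc y)) = \<tau> (Suc (Suc y))"
  shows "subst \<sigma> P = subst \<tau> P"
  by (rule subst_cong) (metis assms nat_cases3)

lemma weak_subst: "weak l (subst \<sigma> P) = subst (under l \<sigma>) (weak l P)"
  unfolding weak_def under_def by (auto simp: subst_subst intro!: subst_cong)

lemma exch_subst: "exch l (subst (under l (lift \<sigma>)) P) = subst (lift (under l \<sigma>)) (exch l P)"
  unfolding exch_def under_def by (auto simp: subst_subst intro!: subst_eqI)

lemma subst_inst: "subst (inst (\<sigma> b)) (subst (lift \<sigma>) P) = subst \<sigma> (subst (inst b) P)"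
  by (auto simp: subst_subst intro!: subst_eqI)

text \<open>No rule requires two free names to differ, so even a non-injective
  \<open>\<sigma>\<close> preserves every transition. The converse is what fails, and only for
  silent ones.\<close>

lemma tr_subst: "tr P l P' \<Longrightarrow> tr (subst \<sigma> P) (lmap \<sigma> l) (subst (under l \<sigma>) P')"
proof (induction arbitrary: \<sigma> rule: tr.induct)
  case (tr_Rep G l P')
  then show ?case by (auto intro: tr.tr_Rep)
next
  case (tr_Open P a P')
  from tr_Open.IH[of "lift \<sigma>"] show ?case by (auto intro: tr.tr_Open)
next
  case (tr_New P l P')
  have "tr (subst (lift \<sigma>) P) (lmap Suc (lmap \<sigma> l)) (subst (under l (lift \<sigma>)) P')"
    using tr_New.IH[of "lift \<sigma>"] by (simp add: lmap_lmap comp_def)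
  from tr.tr_New[OF this] show ?case
    by (simp add: exch_def under_def exch_subst[unfolded exch_def under_def] split: if_splits)
next
  case (tr_ParL P l P' Q)
  from tr.tr_ParL[OF tr_ParL.IH[of \<sigma>], of "subst \<sigma> Q"] show ?case
    by (simp add: weak_subst)
next
  case (tr_ParR Q l Q' P)
  from tr.tr_ParR[OF tr_ParR.IH[of \<sigma>], of "subst \<sigma> P"] show ?case
    by (simp add: weak_subst)
next
  case (tr_CommL P a P' Q b Q')
  then show ?case
    using tr.tr_CommL[of "subst \<sigma> P" "\<sigma> a" "subst (lift \<sigma>) P'" "subst \<sigma> Q" "\<sigma> b" "subst \<sigma> Q'"]
    by (simp add: subst_inst)
next
  case (tr_CommR P a b P' Q Q')
  then show ?case
    using tr.tr_CommR[of "subst \<sigma> P" "\<sigma> a" "\<sigma> b" "subst \<sigma> P'" "subst \<sigma> Q" "subst (lift \<sigma>) Q'"]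
    by (simp add: subst_inst)
next
  case (tr_CloseL P a P' Q Q')
  then show ?case by (auto intro: tr.tr_CloseL)
next
  case (tr_CloseR P a P' Q Q')
  then show ?case by (auto intro: tr.tr_CloseR)
qed (auto intro: tr.intros)

lemma subset_insert_Suc: "A \<subseteq> insert 0 (Suc ` {x. Suc x \<in> A})"
proof
  fix x assume "x \<in> A"
  then show "x \<in> insert 0 (Suc ` {x. Suc x \<in> A})" by (cases x) auto
qed

text \<open>The source of freshness arguments: a name fresh for the source can enter the target only
  through index 0.\<close>

lemma tr_fn:
  "tr P l P' \<Longrightarrow> lnames l \<subseteq> fn P \<and> fn P' \<subseteq> (if binds l then insert 0 (Suc ` fn P) else fn P)"
proof (induction rule: tr.induct)
  case (tr_In a P)
  then show ?case using subset_insert_Suc[of "fn P"] by auto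
next
  case (tr_Open P a P')
  then show ?case using subset_insert_Suc[of "fn P"] by auto
next
  case (tr_New P l P')
  show ?case
  proof (cases "binds l")
    case True
    have "fn (NewB (subst flip P')) \<subseteq> insert 0 (Suc ` fn (NewB P))"
    proof
      fix x assume "x \<in> fn (NewB (subst flip P'))"
      then obtain y where y: "y \<in> fn P'" "Suc x = flip y" by (auto simp: fn_subst)
      from y(1) tr_New.IH True have "y \<in> insert 0 (Suc ` fn P)" by auto
      with y(2) show "x \<in> insert 0 (Suc ` fn (NewB P))"
        by (cases y rule: nat_cases3) auto
    qed
    with tr_New.IH True show ?thesis by (auto simp: exch_def lnames_lmap)
  next
    case False
    with tr_New.IH show ?thesis by (auto simp: exch_def lnames_lmap)
  qed
next
  case (tr_ParL P l P' Q)
  then show ?case by (auto simp: weak_def fn_subst split: if_splits)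
next
  case (tr_ParR Q l Q' P)
  then show ?case by (auto simp: weak_def fn_subst split: if_splits)
next
  case (tr_CommL P a P' Q b Q')
  then show ?case by (auto simp: fn_subst image_iff)
next
  case (tr_CommR P a b P' Q Q')
  then show ?case by (auto simp: fn_subst image_iff)
qed (auto split: if_splits)

text \<open>Since \<open>inst 0\<close> is a left inverse of \<open>Suc\<close>,
  \<open>tr_subst\<close> turns the given transition into one of \<open>P\<close>. Nothing is lost
  on the way, because by \<open>tr_fn\<close> the label and the target avoid the index that
  \<open>Suc\<close> misses; the 0 in \<open>inst 0\<close> is arbitrary.\<close>

lemma tr_subst_Suc_inv:
  assumes "tr (subst Suc P) l P'"
  obtains l0 P0 where "tr P l0 P0" "l = lmap Suc l0" "P' = subst (under l0 Suc) P0"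
proof -
  let ?pred = "inst 0"
  have fn: "lnames l \<subseteq> Suc ` fn P" "fn P' \<subseteq> (if binds l then insert 0 (Suc ` Suc ` fn P) else Suc ` fn P)"
    using tr_fn[OF assms] by (auto simp: fn_subst)
  have "subst ?pred (subst Suc P) = P"
    by (simp add: subst_subst subst_ident)
  with tr_subst[OF assms, of ?pred] have "tr P (lmap ?pred l) (subst (under l ?pred) P')"
    by simp
  moreover have "l = lmap Suc (lmap ?pred l)"
    using fn(1) by (cases l) auto
  moreover have "P' = subst (under (lmap ?pred l) Suc) (subst (under l ?pred) P')"
    using fn(2) by (auto simp: subst_subst under_def subst_ident split: if_splits intro!: subst_ident[symmetric])
  ultimately show thesis by (rule that)
qed

section \<open>Agreement with the early transition system\<close>

fun lab_of :: "act \<Rightarrow> lab" where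
  "lab_of (AOut a b) = LOut a b"
| "lab_of (ABOut a b) = LBOut a"
| "lab_of (AIn a b) = LIn a"
| "lab_of ATau = LTau"

text \<open>An early action is a late label together with an opening of its target: the name
  forgotten by \<open>lab_of\<close> is put at index 0 by \<open>sub_of\<close>.\<close>

primrec sub_of :: "act \<Rightarrow> name \<Rightarrow> name" where
  "sub_of (AOut a b) = id"
| "sub_of (ABOut a b) = inst b"
| "sub_of (AIn a b) = inst b"
| "sub_of ATau = id"

text \<open>Restrictions occur in a guarded sum only below prefixes. This settles the sum rules,
  which put no freshness condition on the other summand.\<close>

lemma Gd_no_LBOut: "tr P l P' \<Longrightarrow> P = Gd G \<Longrightarrow> l \<noteq> LBOut a"
  by (induction arbitrary: G rule: tr.induct) auto

lemma inst_close: "subst (inst b) (close a P) = subst (id(a := b)) P"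
  unfolding close_def subst_subst by (rule subst_cong) auto

lemma inst_close_same: "subst (inst b) (close b P) = P"
  unfolding close_def subst_subst by (rule subst_ident) auto

text \<open>By \<open>tr_fn\<close>, a name fresh for the source does not occur in the target, so
  opening index 0 with it is undone by closing.\<close>

lemma close_inst:
  assumes "tr P l Q" "binds l" "b \<notin> fn P"
  shows "close b (subst (inst b) Q) = Q"
  unfolding close_def subst_subst
  by (rule subst_ident) (use tr_fn[OF assms(1)] assms in auto)

lemma subst_sub_of_weak: "subst (sub_of \<mu>) (weak (lab_of \<mu>) P) = P"
  by (cases \<mu>) (auto simp: subst_subst subst_id intro!: subst_ident)

text \<open>The named rule \<open>Res\<close> opens the target of the label and then binds
  \<open>a\<close>; the de Bruijn rule does this the other way round. As \<open>a\<close> is not the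
  name of the label, the results differ only by the order of two indices, which \<open>exch\<close>
  repairs.\<close>

lemma close_sub_of:
  assumes "a \<notin> names \<mu>"
  shows "close a (subst (sub_of \<mu>) Q) = subst (lift (sub_of \<mu>))
    (exch (lab_of \<mu>) (subst (under (lab_of \<mu>) (\<lambda>x. if x = a then 0 else Suc x)) Q))"
  using assms
  by (cases \<mu>) (auto simp: close_def subst_subst subst_id lift_id intro!: subst_eqI)

lemma lts_imp_tr:
  "P \<longmapsto>[\<mu>] P' \<Longrightarrow> \<exists>Q. tr P (lab_of \<mu>) Q \<and> P' = subst (sub_of \<mu>) Q \<and> bn \<mu> \<inter> fn P = {}"
proof (induction rule: lts.induct)
  case (In a b P c)
  then show ?case by (auto simp: inp_def inst_close intro: tr_In)
next
  case (Out a b P)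
  then show ?case by (auto simp: subst_id intro: tr_Out)
next
  case (Tau P)
  then show ?case by (auto simp: subst_id intro: tr_Tau)
next
  case (Rep G \<mu> P')
  then show ?case by (auto intro: tr_Rep)
next
  case (Open P a b P')
  then have "tr P (LOut a b) P'" by (simp add: subst_id)
  from tr_subst[OF this, of "\<lambda>x. if x = b then 0 else Suc x"] \<open>b \<noteq> a\<close>
  have "tr (res b P) (LBOut a) (close b P')"
    by (auto simp: res_def close_def intro: tr_Open)
  then show ?case by (auto simp: inst_close_same fn_res)
next
  case (SumL G \<mu> P' G')
  then obtain Q where Q: "tr (Gd G) (lab_of \<mu>) Q" "P' = subst (sub_of \<mu>) Q" by blast
  from Gd_no_LBOut[OF Q(1) refl] have "bn \<mu> = {}" by (cases \<mu>) auto
  with Q show ?case by (auto intro: tr_SumL)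
next
  case (SumR G \<mu> P' G')
  then obtain Q where Q: "tr (Gd G) (lab_of \<mu>) Q" "P' = subst (sub_of \<mu>) Q" by blast
  from Gd_no_LBOut[OF Q(1) refl] have "bn \<mu> = {}" by (cases \<mu>) auto
  with Q show ?case by (auto intro: tr_SumR)
next
  case (Res P \<mu> P' a)
  then obtain Q where Q: "tr P (lab_of \<mu>) Q" "P' = subst (sub_of \<mu>) Q" "bn \<mu> \<inter> fn P = {}" by blast
  let ?\<kappa> = "\<lambda>x. if x = a then 0 else Suc x"
  have "lmap ?\<kappa> (lab_of \<mu>) = lmap Suc (lab_of \<mu>)"
    using Res.hyps(2) by (cases \<mu>) auto
  with tr_subst[OF Q(1), of ?\<kappa>]
  have "tr (close a P) (lmap Suc (lab_of \<mu>)) (subst (under (lab_of \<mu>) ?\<kappa>) Q)"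
    by (simp add: close_def)
  from tr_New[OF this]
  have "tr (res a P) (lab_of \<mu>) (NewB (exch (lab_of \<mu>) (subst (under (lab_of \<mu>) ?\<kappa>) Q)))"
    by (simp add: res_def)
  moreover have "res a P' = subst (sub_of \<mu>) (NewB (exch (lab_of \<mu>) (subst (under (lab_of \<mu>) ?\<kappa>) Q)))"
    using close_sub_of[OF Res.hyps(2), of Q] Q(2) by (simp add: res_def)
  moreover have "bn \<mu> \<inter> fn (res a P) = {}"
    using Q(3) by (auto simp: fn_res)
  ultimately show ?case by blast
next
  case (ParL P \<mu> P' Q)
  then show ?case by (force simp: subst_sub_of_weak intro!: tr_ParL)
next
  case (ParR Q \<mu> Q' P)
  then show ?case by (force simp: subst_sub_of_weak intro!: tr_ParR)
next
  case (CommL P a b P' Q Q')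
  then show ?case by (auto simp: subst_id intro: tr_CommL)
next
  case (CommR P a b P' Q Q')
  then show ?case by (auto simp: subst_id intro: tr_CommR)
next
  case (CloseL P a b P' Q Q')
  then obtain P0 Q0 where *: "tr P (LIn a) P0" "P' = subst (inst b) P0"
    "tr Q (LBOut a) Q0" "Q' = subst (inst b) Q0" "b \<notin> fn Q" by auto
  then have "res b (Par P' Q') = NewB (Par P0 Q0)"
    using close_inst[OF *(1)] close_inst[OF *(3)] CloseL.hyps by (simp add: res_def close_def)
  with tr_CloseL[OF *(1,3)] show ?case by (auto simp: subst_id simp del: subst.simps)
next
  case (CloseR P a b P' Q Q')
  then obtain P0 Q0 where *: "tr P (LBOut a) P0" "P' = subst (inst b) P0"
    "tr Q (LIn a) Q0" "Q' = subst (inst b) Q0" "b \<notin> fn P" by auto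
  then have "res b (Par P' Q') = NewB (Par P0 Q0)"
    using close_inst[OF *(1)] close_inst[OF *(3)] CloseR.hyps by (simp add: res_def close_def)
  with tr_CloseR[OF *(1,3)] show ?case by (auto simp: subst_id simp del: subst.simps)
qed

text \<open>Gives a de Bruijn binder the fresh bound name \<open>n\<close>:
  \<open>case_nat n \<sigma>\<close> acts as \<open>\<sigma>\<close> on free names and sends index 0
  to \<open>n\<close>.\<close>

lemma close_case_nat:
  assumes "\<And>x. Suc x \<in> fn P \<Longrightarrow> \<sigma> x \<noteq> n"
  shows "subst (lift \<sigma>) P = close n (subst (case_nat n \<sigma>) P)"
  unfolding close_def subst_subst
proof (rule subst_cong)
  fix x assume "x \<in> fn P"
  with assms show "lift \<sigma> x = ((\<lambda>x. if x = n then 0 else Suc x) \<circ> case_nat n \<sigma>) x"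
    by (cases x) auto
qed

lemma inst_lift: "subst (inst b) (subst (lift \<sigma>) P) = subst (case_nat b \<sigma>) P"
  by (auto simp: subst_subst intro!: subst_eqI)

lemma fresh_name: "finite (A :: name set) \<Longrightarrow> \<exists>n. n \<notin> A"
  using ex_new_if_finite[OF infinite_UNIV_nat] by blast

lemma finite_names: "finite (names \<mu>)"
  by (cases \<mu>) auto

text \<open>The substitution is there for the induction. The named rules need the body of
  \<open>NewB P\<close> with its index 0 replaced by a fresh name; that is not a subterm, but it is
  \<open>subst (case_nat n \<sigma>) P\<close>, an instance of the induction hypothesis.\<close>

lemma tr_imp_lts_subst:
  "tr P l P' \<Longrightarrow> lab_of \<mu> = lmap \<sigma> l \<Longrightarrow> bn \<mu> \<inter> fn (subst \<sigma> P) = {} \<Longrightarrow>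
    subst \<sigma> P \<longmapsto>[\<mu>] subst (sub_of \<mu>) (subst (under l \<sigma>) P')"
proof (induction arbitrary: \<sigma> \<mu> rule: tr.induct)
  case (tr_In a P)
  then obtain c where \<mu>: "\<mu> = AIn (\<sigma> a) c" by (cases \<mu>) auto
  obtain n where n: "n \<notin> \<sigma> ` {x. Suc x \<in> fn P}"
    using fresh_name[of "\<sigma> ` {x. Suc x \<in> fn P}"] finite_Suc_vimage[OF finite_fn] by blast
  have eq: "subst (lift \<sigma>) P = close n (subst (case_nat n \<sigma>) P)"
    by (rule close_case_nat) (use n in blast)
  then show ?case using lts.In[of "\<sigma> a" n "subst (case_nat n \<sigma>) P" c]
    by (simp add: \<mu> inp_def inst_close)
next
  case (tr_Out a b P)
  then have "\<mu> = AOut (\<sigma> a) (\<sigma> b)" by (cases \<mu>) auto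
  then show ?case by (auto simp: subst_id intro: lts.Out)
next
  case (tr_Tau P)
  then have "\<mu> = ATau" by (cases \<mu>) auto
  then show ?case by (auto simp: subst_id intro: lts.Tau)
next
  case (tr_Rep G l P')
  then show ?case by (auto intro!: lts.Rep)
next
  case (tr_SumL G l P' H)
  then show ?case by (auto intro!: lts.SumL)
next
  case (tr_SumR G l P' H)
  then show ?case by (auto intro!: lts.SumR)
next
  case (tr_Open P a P')
  then obtain b where \<mu>: "\<mu> = ABOut (\<sigma> a) b" by (cases \<mu>) auto
  have b: "b \<notin> \<sigma> ` {x. Suc x \<in> fn P}"
    using tr_Open.prems by (auto simp: \<mu> fn_subst lift_Suc_image)
  have eq: "subst (lift \<sigma>) P = close b (subst (case_nat b \<sigma>) P)"
    by (rule close_case_nat) (use b in blast)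
  \<comment> \<open>The channel of the output is free in the source, so the fresh \<open>b\<close>
    differs from it, as \<open>Open\<close> demands.\<close>
  have "Suc a \<in> fn P" using tr_fn[OF tr_Open.hyps] by simp
  with b have "b \<noteq> \<sigma> a" by blast
  moreover have "subst (case_nat b \<sigma>) P \<longmapsto>[AOut (\<sigma> a) b] subst (case_nat b \<sigma>) P'"
    using tr_Open.IH[of "AOut (\<sigma> a) b" "case_nat b \<sigma>"] by (simp add: subst_id)
  ultimately show ?case
    using lts.Open by (simp add: \<mu> eq inst_lift res_def)
next
  case (tr_New P l P')
  let ?A = "\<sigma> ` {x. Suc x \<in> fn P}" and ?B = "{x. Suc (Suc x) \<in> fn P'}"
  \<comment> \<open>Free names of the target sit above two indices if \<open>l\<close> binds and
    above one otherwise; \<open>n\<close> avoids both readings.\<close>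
  have "finite (?A \<union> \<sigma> ` {x. Suc x \<in> fn P'} \<union> \<sigma> ` ?B \<union> names \<mu>)"
    using finite_Suc_vimage[OF finite_fn] finite_Suc_vimage[OF finite_Suc_vimage[OF finite_fn]]
    by (simp add: finite_names)
  from fresh_name[OF this] obtain n where n: "n \<notin> ?A" "n \<notin> \<sigma> ` {x. Suc x \<in> fn P'}" "n \<notin> \<sigma> ` ?B" "n \<notin> names \<mu>"
    by blast
  let ?\<sigma> = "case_nat n \<sigma>"
  have eq: "subst (lift \<sigma>) P = close n (subst ?\<sigma> P)"
    by (rule close_case_nat) (use n in blast)
  have "lab_of \<mu> = lmap ?\<sigma> (lmap Suc l)"
    using tr_New.prems by (simp add: lmap_lmap comp_def)
  moreover have "bn \<mu> \<inter> fn (subst ?\<sigma> P) = {}"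
  proof -
    have "subst \<sigma> (NewB P) = res n (subst ?\<sigma> P)" by (simp add: eq res_def)
    then have "bn \<mu> \<inter> (fn (subst ?\<sigma> P) - {n}) = {}"
      using tr_New.prems(2) by (simp only: fn_res)
    moreover have "n \<notin> bn \<mu>" using n(4) by (cases \<mu>) auto
    ultimately show ?thesis by blast
  qed
  ultimately have "subst ?\<sigma> P \<longmapsto>[\<mu>] subst (sub_of \<mu>) (subst (under (lmap Suc l) ?\<sigma>) P')"
    by (rule tr_New.IH)
  then have "subst ?\<sigma> P \<longmapsto>[\<mu>] subst (sub_of \<mu>) (subst (under l ?\<sigma>) P')"
    by simp
  from lts.Res[OF this n(4)]
  have "subst \<sigma> (NewB P) \<longmapsto>[\<mu>] res n (subst (sub_of \<mu>) (subst (under l ?\<sigma>) P'))"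
    by (simp add: eq res_def)
  moreover have "res n (subst (sub_of \<mu>) (subst (under l ?\<sigma>) P')) =
      subst (sub_of \<mu>) (subst (under l \<sigma>) (NewB (exch l P')))"
  proof -
    have "close n (subst (sub_of \<mu>) (subst (under l ?\<sigma>) P')) =
      subst (lift (sub_of \<mu>)) (subst (lift (under l \<sigma>)) (exch l P'))"
    proof (cases "binds l")
      case True
      then obtain c where \<mu>: "sub_of \<mu> = inst c" "c \<in> names \<mu>"
        using tr_New.prems(1) by (cases \<mu>; cases l) auto
      show ?thesis
        unfolding close_def exch_def under_def subst_subst
        using True \<mu> n
        apply (simp add: subst_subst)
        apply (rule subst_cong)
        subgoal for x by (cases x rule: nat_cases3) auto
        done
    next
      case False
      then have \<mu>: "sub_of \<mu> = id"
        using tr_New.prems(1) by (cases \<mu>; cases l) auto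
      have "subst (lift \<sigma>) P' = close n (subst ?\<sigma> P')"
        by (rule close_case_nat) (use n in blast)
      then show ?thesis
        using False \<mu> by (simp add: exch_def under_def subst_id lift_id)
    qed
    then show ?thesis by (simp add: res_def)
  qed
  ultimately show ?case by simp
next
  case (tr_ParL P l P' Q)
  have "subst (sub_of \<mu>) (subst (under l \<sigma>) (weak l Q)) = subst \<sigma> Q"
    using tr_ParL.prems(1) subst_sub_of_weak[of \<mu> "subst \<sigma> Q"] by (simp add: weak_subst)
  then show ?case using tr_ParL by (auto intro!: lts.ParL)
next
  case (tr_ParR Q l Q' P)
  have "subst (sub_of \<mu>) (subst (under l \<sigma>) (weak l P)) = subst \<sigma> P"
    using tr_ParR.prems(1) subst_sub_of_weak[of \<mu> "subst \<sigma> P"] by (simp add: weak_subst)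
  then show ?case using tr_ParR by (auto intro!: lts.ParR)
next
  case (tr_CommL P a P' Q b Q')
  from tr_CommL.prems have \<mu>: "\<mu> = ATau" by (cases \<mu>) auto
  show ?case
    using tr_CommL.IH(1)[of "AIn (\<sigma> a) (\<sigma> b)" \<sigma>] tr_CommL.IH(2)[of "AOut (\<sigma> a) (\<sigma> b)" \<sigma>]
    by (auto simp: \<mu> subst_id subst_inst intro: lts.CommL)
next
  case (tr_CommR P a b P' Q Q')
  from tr_CommR.prems have \<mu>: "\<mu> = ATau" by (cases \<mu>) auto
  show ?case
    using tr_CommR.IH(2)[of "AIn (\<sigma> a) (\<sigma> b)" \<sigma>] tr_CommR.IH(1)[of "AOut (\<sigma> a) (\<sigma> b)" \<sigma>]
    by (auto simp: \<mu> subst_id subst_inst intro: lts.CommR)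
next
  case (tr_CloseL P a P' Q Q')
  from tr_CloseL.prems have \<mu>: "\<mu> = ATau" by (cases \<mu>) auto
  obtain b where b: "b \<notin> fn (subst \<sigma> P)" "b \<notin> fn (subst \<sigma> Q)"
    using fresh_name[of "fn (subst \<sigma> P) \<union> fn (subst \<sigma> Q)"] finite_fn by blast
  have "close b (subst (inst b) (subst (lift \<sigma>) P')) = subst (lift \<sigma>) P'"
    "close b (subst (inst b) (subst (lift \<sigma>) Q')) = subst (lift \<sigma>) Q'"
    using close_inst[OF tr_subst[OF tr_CloseL.hyps(1), of \<sigma>] _ b(1)]
      close_inst[OF tr_subst[OF tr_CloseL.hyps(2), of \<sigma>] _ b(2)] by simp_all
  then show ?case
    using tr_CloseL.IH(1)[of "AIn (\<sigma> a) b" \<sigma>] tr_CloseL.IH(2)[of "ABOut (\<sigma> a) b" \<sigma>] b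
      lts.CloseL[of "subst \<sigma> P" "\<sigma> a" b "subst (inst b) (subst (lift \<sigma>) P')" "subst \<sigma> Q"
        "subst (inst b) (subst (lift \<sigma>) Q')"]
    by (simp add: \<mu> subst_id res_def close_def)
next
  case (tr_CloseR P a P' Q Q')
  from tr_CloseR.prems have \<mu>: "\<mu> = ATau" by (cases \<mu>) auto
  obtain b where b: "b \<notin> fn (subst \<sigma> P)" "b \<notin> fn (subst \<sigma> Q)"
    using fresh_name[of "fn (subst \<sigma> P) \<union> fn (subst \<sigma> Q)"] finite_fn by blast
  have "close b (subst (inst b) (subst (lift \<sigma>) P')) = subst (lift \<sigma>) P'"
    "close b (subst (inst b) (subst (lift \<sigma>) Q')) = subst (lift \<sigma>) Q'"
    using close_inst[OF tr_subst[OF tr_CloseR.hyps(1), of \<sigma>] _ b(1)]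
      close_inst[OF tr_subst[OF tr_CloseR.hyps(2), of \<sigma>] _ b(2)] by simp_all
  then show ?case
    using tr_CloseR.IH(2)[of "AIn (\<sigma> a) b" \<sigma>] tr_CloseR.IH(1)[of "ABOut (\<sigma> a) b" \<sigma>] b
      lts.CloseR[of "subst \<sigma> P" "\<sigma> a" b "subst (inst b) (subst (lift \<sigma>) P')" "subst \<sigma> Q"
        "subst (inst b) (subst (lift \<sigma>) Q')"]
    by (simp add: \<mu> subst_id res_def close_def)
qed

lemma lts_iff_tr:
  "P \<longmapsto>[\<mu>] P' \<longleftrightarrow> (\<exists>Q. tr P (lab_of \<mu>) Q \<and> P' = subst (sub_of \<mu>) Q \<and> bn \<mu> \<inter> fn P = {})"
proof
  assume "\<exists>Q. tr P (lab_of \<mu>) Q \<and> P' = subst (sub_of \<mu>) Q \<and> bn \<mu> \<inter> fn P = {}"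
  then obtain Q where Q: "tr P (lab_of \<mu>) Q" "P' = subst (sub_of \<mu>) Q" "bn \<mu> \<inter> fn P = {}" by blast
  have "lab_of \<mu> = lmap id (lab_of \<mu>)" by (cases \<mu>) auto
  moreover have "subst (under (lab_of \<mu>) id) Q = Q" by (simp add: under_def lift_id subst_id)
  ultimately show "P \<longmapsto>[\<mu>] P'"
    using tr_imp_lts_subst[OF Q(1), of \<mu> id] Q(2,3) by (simp add: subst_id)
qed (rule lts_imp_tr)

section \<open>The congruence closure\<close>

text \<open>No clause refers to the set of processes under consideration: only the pairs in \<open>S\<close> need lie in
  it.  Closure under substitution is admissible, since substitutions can be pushed down to
  \<open>congr_base\<close>.\<close>

inductive_set congr :: "proc rel \<Rightarrow> proc rel" for S where
  congr_base: "(P, Q) \<in> S \<Longrightarrow> (subst \<sigma> P, subst \<sigma> Q) \<in> congr S"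
| congr_refl: "(P, P) \<in> congr S"
| congr_trans: "(P, Q) \<in> congr S \<Longrightarrow> (Q, R) \<in> congr S \<Longrightarrow> (P, R) \<in> congr S"
| congr_new: "(P, Q) \<in> congr S \<Longrightarrow> (NewB P, NewB Q) \<in> congr S"
| congr_par: "(P, Q) \<in> congr S \<Longrightarrow> (P', Q') \<in> congr S \<Longrightarrow> (Par P P', Par Q Q') \<in> congr S"
| congr_sum: "(Gd G, Gd H) \<in> congr S \<Longrightarrow> (Gd G', Gd H') \<in> congr S \<Longrightarrow>
    (Gd (Plus G G'), Gd (Plus H H')) \<in> congr S"
| congr_rep: "(Gd G, Gd H) \<in> congr S \<Longrightarrow> (Bang G, Bang H) \<in> congr S"
| congr_tau: "(P, Q) \<in> congr S \<Longrightarrow> (Gd (Tau P), Gd (Tau Q)) \<in> congr S"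
| congr_out: "(P, Q) \<in> congr S \<Longrightarrow> (Gd (Out a b P), Gd (Out a b Q)) \<in> congr S"
| congr_inp: "(P, Q) \<in> congr S \<Longrightarrow> (Gd (InB a P), Gd (InB a Q)) \<in> congr S"
| congr_swap: "(NewB (NewB P), NewB (NewB (subst flip P))) \<in> congr S"
| congr_comm: "(Par P Q, Par Q P) \<in> congr S"
| congr_extr: "(NewB (Par P (subst Suc Q)), Par (NewB P) Q) \<in> congr S"
| congr_intr: "(Par (NewB P) Q, NewB (Par P (subst Suc Q))) \<in> congr S"

lemma flip_flip [simp]: "subst flip (subst flip P) = P"
  unfolding subst_subst
  by (rule subst_ident) (metis comp_apply flip_simps nat_cases3)

lemma flip_lift_lift: "subst flip (subst (lift (lift \<sigma>)) P) = subst (lift (lift \<sigma>)) (subst flip P)"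
  by (auto simp: subst_subst intro!: subst_eqI)

lemma subst_lift_Suc: "subst (lift \<sigma>) (subst Suc P) = subst Suc (subst \<sigma> P)"
  by (auto simp: subst_subst intro!: subst_cong)

lemma congr_subst: "(P, Q) \<in> congr S \<Longrightarrow> (subst \<sigma> P, subst \<sigma> Q) \<in> congr S"
proof (induction arbitrary: \<sigma> rule: congr.induct)
  case (congr_base P Q \<tau>)
  then show ?case by (simp add: subst_subst congr.congr_base)
next
  case (congr_swap P)
  show ?case
    using congr.congr_swap[of "subst (lift (lift \<sigma>)) P" S] by (simp add: flip_lift_lift)
next
  case (congr_extr P Q)
  show ?case
    using congr.congr_extr[of "subst (lift \<sigma>) P" "subst \<sigma> Q" S] by (simp add: subst_lift_Suc)
next
  case (congr_intr P Q)
  show ?case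
    using congr.congr_intr[of "subst (lift \<sigma>) P" "subst \<sigma> Q" S] by (simp add: subst_lift_Suc)
qed (auto intro: congr.intros)

lemma congr_weak: "(P, Q) \<in> congr S \<Longrightarrow> (weak l P, weak l Q) \<in> congr S"
  by (simp add: weak_def congr_subst)

lemma congr_exch: "(P, Q) \<in> congr S \<Longrightarrow> (exch l P, exch l Q) \<in> congr S"
  by (simp add: exch_def congr_subst)

text \<open>The rules \<open>congr_extr\<close> and \<open>congr_intr\<close> are converse to each
  other; \<open>congr_comm\<close> and \<open>congr_swap\<close> are their own converses, the latter
  because \<open>flip\<close> is an involution. It is therefore enough to match transitions in one
  direction.\<close>

lemma congr_sym:
  assumes "sym S"
  shows "(P, Q) \<in> congr S \<Longrightarrow> (Q, P) \<in> congr S"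
proof (induction rule: congr.induct)
  case (congr_swap P)
  show ?case using congr.congr_swap[of "subst flip P" S] by simp
qed (auto intro: congr.intros dest: symD[OF assms])

section \<open>Matching transitions up to the congruence\<close>

definition matched :: "proc rel \<Rightarrow> proc \<Rightarrow> lab \<Rightarrow> proc \<Rightarrow> bool" where
  "matched S Q l P' \<longleftrightarrow> (\<exists>Q'. tr Q l Q' \<and> (P', Q') \<in> congr S)"

text \<open>The set \<open>L\<close> is a parameter so that one induction serves visible labels
  alone and all labels.\<close>

definition matches :: "lab set \<Rightarrow> proc rel \<Rightarrow> proc \<Rightarrow> proc \<Rightarrow> bool" where
  "matches L S P Q \<longleftrightarrow> (\<forall>l\<in>L. \<forall>P'. tr P l P' \<longrightarrow> matched S Q l P')"

lemma matchesD: "matches L S P Q \<Longrightarrow> l \<in> L \<Longrightarrow> tr P l P' \<Longrightarrow> matched S Q l P'"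
  by (simp add: matches_def)

lemma matchesI: "(\<And>l P'. l \<in> L \<Longrightarrow> tr P l P' \<Longrightarrow> matched S Q l P') \<Longrightarrow> matches L S P Q"
  by (simp add: matches_def)

lemma matches_mono: "matches L S P Q \<Longrightarrow> K \<subseteq> L \<Longrightarrow> matches K S P Q"
  by (auto simp: matches_def)

lemma matchedI: "tr Q l Q' \<Longrightarrow> (P', Q') \<in> congr S \<Longrightarrow> matched S Q l P'"
  by (auto simp: matched_def)

lemma matched_refl: "tr Q l Q' \<Longrightarrow> matched S Q l Q'"
  by (blast intro: matchedI congr_refl)

lemma matched_Rep: "matched S (Par (Bang G) (Gd G)) l P' \<Longrightarrow> matched S (Bang G) l P'"
  by (auto simp: matched_def intro: tr_Rep)

lemma matched_Open: "matched S Q (LOut (Suc a) 0) P' \<Longrightarrow> matched S (NewB Q) (LBOut a) P'"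
  by (auto simp: matched_def intro: tr_Open)

lemma matched_New: "matched S Q (lmap Suc l) P' \<Longrightarrow> matched S (NewB Q) l (NewB (exch l P'))"
  by (auto simp: matched_def intro!: tr_New congr_new congr_exch)

lemma matched_Sum:
  "matched S (Gd G) l P' \<Longrightarrow> matched S (Gd (Plus G H)) l P'"
  "matched S (Gd G) l P' \<Longrightarrow> matched S (Gd (Plus H G)) l P'"
  by (auto simp: matched_def intro: tr_SumL tr_SumR)

lemma matched_ParL:
  "matched S Q l P' \<Longrightarrow> (R, R') \<in> congr S \<Longrightarrow> matched S (Par Q R') l (Par P' (weak l R))"
  by (auto simp: matched_def intro!: tr_ParL congr_par congr_weak)

lemma matched_ParR:
  "matched S Q l P' \<Longrightarrow> (R, R') \<in> congr S \<Longrightarrow> matched S (Par R' Q) l (Par (weak l R) P')"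
  by (auto simp: matched_def intro!: tr_ParR congr_par congr_weak)

lemma matched_CommL:
  "matched S P (LIn a) P' \<Longrightarrow> matched S Q (LOut a b) Q' \<Longrightarrow>
    matched S (Par P Q) LTau (Par (subst (inst b) P') Q')"
  by (auto simp: matched_def) (metis tr_CommL congr_par congr_subst)

lemma matched_CommR:
  "matched S P (LOut a b) P' \<Longrightarrow> matched S Q (LIn a) Q' \<Longrightarrow>
    matched S (Par P Q) LTau (Par P' (subst (inst b) Q'))"
  by (auto simp: matched_def) (metis tr_CommR congr_par congr_subst)

lemma matched_CloseL:
  "matched S P (LIn a) P' \<Longrightarrow> matched S Q (LBOut a) Q' \<Longrightarrow>
    matched S (Par P Q) LTau (NewB (Par P' Q'))"
  by (auto simp: matched_def) (metis tr_CloseL congr_par congr_new)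

lemma matched_CloseR:
  "matched S P (LBOut a) P' \<Longrightarrow> matched S Q (LIn a) Q' \<Longrightarrow>
    matched S (Par P Q) LTau (NewB (Par P' Q'))"
  by (auto simp: matched_def) (metis tr_CloseR congr_par congr_new)

section \<open>The structural laws match all transitions\<close>

lemma matches_comm: "matches UNIV S (Par P Q) (Par Q P)"
proof (rule matchesI)
  fix l Z assume "tr (Par P Q) l Z"
  then show "matched S (Par Q P) l Z"
    by (cases rule: tr_ParE)
      (auto intro: matchedI tr_ParL tr_ParR tr_CommL tr_CommR tr_CloseL tr_CloseR congr_comm congr_new)
qed

lemma exch_weak_Suc: "exch l (weak l (subst Suc R)) = subst Suc (weak l R)"
  by (auto simp: exch_def weak_def subst_subst intro!: subst_cong)

lemma weak_NewB: "weak l (NewB P) = NewB (exch l (weak l P))"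
  by (auto simp: exch_def weak_def subst_subst intro!: subst_eqI)

lemma exch_under_Suc: "exch l (subst (under l Suc) R) = subst Suc R"
  by (auto simp: exch_def under_def subst_subst intro!: subst_eqI)

lemma flip_lift_Suc: "subst flip (subst (lift Suc) R) = subst Suc R"
  by (auto simp: subst_subst intro!: subst_eqI)

lemma inst_NewB: "subst (inst b) (NewB (subst flip P)) = NewB (subst (inst (Suc b)) P)"
  by (auto simp: subst_subst intro!: subst_eqI)

lemma inst_0_lift_Suc: "subst (inst 0) (subst (lift Suc) R) = R"
  unfolding subst_subst by (rule subst_ident) (metis comp_apply inst_simps lift_simps nat_cases3)

lemma inst_Suc: "subst (inst b) (subst Suc R) = R"
  by (auto simp: subst_subst intro: subst_ident)

lemma inj_lmap: "inj \<sigma> \<Longrightarrow> lmap \<sigma> l = lmap \<sigma> m \<Longrightarrow> l = m"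
  by (cases l; cases m) (auto dest: injD)

lemma exch_Par [simp]: "exch l (Par P Q) = Par (exch l P) (exch l Q)"
  by (simp add: exch_def)

lemma matches_intr: "matches UNIV S (Par (NewB P) R) (NewB (Par P (subst Suc R)))"
proof (rule matchesI)
  fix l Z assume "tr (Par (NewB P) R) l Z"
  then show "matched S (NewB (Par P (subst Suc R))) l Z"
  proof (cases rule: tr_ParE)
    case (1 Z1)
    from 1(2) show ?thesis
    proof (cases rule: tr_NewE)
      case (1 a)
      from tr_Open[OF tr_ParL[OF 1(2)], of "subst Suc R"] 1(1) \<open>Z = _\<close> show ?thesis
        by (auto intro: matched_refl)
    next
      case (2 P1)
      from tr_New[OF tr_ParL[OF 2(2)], of "subst Suc R"] 2(1) \<open>Z = _\<close> show ?thesis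
        by (auto simp: exch_weak_Suc weak_def intro: congr_intr matchedI split: if_splits)
          (metis exch_weak_Suc weak_def congr_intr matchedI)+
    qed
  next
    case (2 R1)
    have "tr (NewB (Par P (subst Suc R))) l (NewB (exch l (Par (weak (lmap Suc l) P) (subst (under l Suc) R1))))"
      by (intro tr_New tr_ParR tr_subst 2)
    with 2(1) show ?thesis
      by (auto simp: exch_under_Suc weak_NewB intro!: matchedI congr_intr)
  next
    case (3 a Z1 b R1)
    from 3(3) obtain P1 where P1: "tr P (LIn (Suc a)) P1" "Z1 = NewB (subst flip P1)"
      by (cases rule: tr_NewE) auto
    from tr_New[where l = LTau, simplified, OF tr_CommL[OF P1(1)]] tr_subst[OF 3(4), of Suc]
    have "tr (NewB (Par P (subst Suc R))) LTau (NewB (Par (subst (inst (Suc b)) P1) (subst Suc R1)))"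
      by simp
    then show ?thesis
      unfolding 3(1,2) P1(2) inst_NewB by (rule matchedI) (rule congr_intr)
  next
    case (4 a b Z1 R1)
    from 4(3) obtain P1 where P1: "tr P (LOut (Suc a) (Suc b)) P1" "Z1 = NewB P1"
      by (cases rule: tr_NewE) auto
    have "tr (subst Suc R) (LIn (Suc a)) (subst (lift Suc) R1)"
      using tr_subst[OF 4(4), of Suc] by simp
    from tr_New[where l = LTau, simplified, OF tr_CommR[OF P1(1) this]]
    have "tr (NewB (Par P (subst Suc R))) LTau (NewB (Par P1 (subst Suc (subst (inst b) R1))))"
      using subst_inst[of Suc b R1] by simp
    then show ?thesis
      unfolding 4(1,2) P1(2) by (rule matchedI) (rule congr_intr)
  next
    case (5 a Z1 R1)
    from 5(3) obtain P1 where P1: "tr P (LIn (Suc a)) P1" "Z1 = NewB (subst flip P1)"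
      by (cases rule: tr_NewE) auto
    from tr_New[where l = LTau, simplified, OF tr_CloseL[OF P1(1)]] tr_subst[OF 5(4), of Suc]
    have *: "tr (NewB (Par P (subst Suc R))) LTau (NewB (NewB (Par P1 (subst (lift Suc) R1))))"
      by simp
    \<comment> \<open>The binder of the extruded name and the restriction of \<open>P\<close> come
      out in opposite orders on the two sides.\<close>
    have "(NewB (Par (NewB (subst flip P1)) R1), NewB (NewB (Par (subst flip P1) (subst Suc R1)))) \<in> congr S"
      by (intro congr_new congr_intr)
    from congr_trans[OF this congr_swap] show ?thesis
      unfolding 5(1,2) P1(2) using * by (auto intro: matchedI simp: flip_lift_Suc[symmetric])
  next
    case (6 a Z1 R1)
    from 6(3) show ?thesis
    proof (cases rule: tr_NewE)
      case (1 a')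
      \<comment> \<open>The restricted name itself is extruded. Inside the restriction this is a
        plain communication of index 0, and the residuals are equal.\<close>
      then have "tr (Par P (subst Suc R)) LTau (Par Z1 R1)"
        using tr_CommR[OF 1(2)] tr_subst[OF 6(4), of Suc] inst_0_lift_Suc[of R1]
        by simp metis
      with 6(1,2) show ?thesis using tr_New[where l = LTau] by (auto intro: matched_refl)
    next
      case (2 P1)
      from tr_New[where l = LTau, simplified, OF tr_CloseR] 2(2) tr_subst[OF 6(4), of Suc]
      have *: "tr (NewB (Par P (subst Suc R))) LTau (NewB (NewB (Par P1 (subst (lift Suc) R1))))"
        by simp
      have "(NewB (Par (NewB (subst flip P1)) R1), NewB (NewB (Par (subst flip P1) (subst Suc R1)))) \<in> congr S"
        by (intro congr_new congr_intr)
      from congr_trans[OF this congr_swap] show ?thesis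
        unfolding 6(1,2) 2(1) using * by (auto intro: matchedI simp: flip_lift_Suc[symmetric])
    qed
  qed
qed

lemma matches_extr: "matches UNIV S (NewB (Par P (subst Suc R))) (Par (NewB P) R)"
proof (rule matchesI)
  fix l Z assume "tr (NewB (Par P (subst Suc R))) l Z"
  then show "matched S (Par (NewB P) R) l Z"
  proof (cases rule: tr_NewE)
    case (1 a)
    from 1(2) show ?thesis
    proof (cases rule: tr_ParE)
      case (1 P1)
      from tr_ParL[OF tr_Open[OF 1(2)], of R] 1(1) \<open>l = _\<close> show ?thesis
        by (auto intro: matched_refl)
    next
      case (2 R1)
      \<comment> \<open>A process weakened by \<open>Suc\<close> cannot send index 0, so this case
        is void.\<close>
      from 2(2) show ?thesis
      proof (rule tr_subst_Suc_inv)
        fix l0 assume "LOut (Suc a) 0 = lmap Suc l0"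
        then show ?thesis by (cases l0) auto
      qed
    qed auto
  next
    case (2 Z1)
    note Z = 2(1)
    from 2(2) show ?thesis
    proof (cases rule: tr_ParE)
      case (1 P1)
      from tr_ParL[OF tr_New[OF 1(2)], of R] show ?thesis
        unfolding Z 1(1) by (rule matchedI) (simp add: exch_weak_Suc congr_extr)
    next
      case (2 R1)
      obtain R0 where R0: "tr R l R0" "R1 = subst (under l Suc) R0"
        using tr_subst_Suc_inv[OF 2(2)] inj_lmap[OF inj_Suc] by metis
      from tr_ParR[OF R0(1), of "NewB P"] show ?thesis
        unfolding Z 2(1) R0(2)
        by (rule matchedI) (simp add: exch_under_Suc weak_NewB congr_extr)
    next
      case (3 a P1 b R1)
      obtain m R0 where R0: "tr R m R0" "LOut a b = lmap Suc m" "R1 = subst (under m Suc) R0"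
        using tr_subst_Suc_inv[OF 3(4)] by metis
      then obtain a0 b0 where m: "m = LOut a0 b0" "a = Suc a0" "b = Suc b0" by (cases m) auto
      have l: "l = LTau" using 3(1) by simp
      have "tr (NewB P) (LIn a0) (NewB (subst flip P1))"
        using tr_New[of P "LIn a0" P1] 3(3) m by simp
      from tr_CommL[OF this] R0(1) m
      have "tr (Par (NewB P) R) LTau (Par (NewB (subst (inst (Suc b0)) P1)) R0)"
        by (metis inst_NewB)
      then show ?thesis
        unfolding Z 3(2) l by (rule matchedI) (simp add: R0(3) m congr_extr)
    next
      case (4 a b P1 R1)
      obtain m R0 where R0: "tr R m R0" "LIn a = lmap Suc m" "R1 = subst (under m Suc) R0"
        using tr_subst_Suc_inv[OF 4(4)] by metis
      then obtain a0 where m: "m = LIn a0" "a = Suc a0" by (cases m) auto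
      have l: "l = LTau" using 4(1) by simp
      show ?thesis
      \<comment> \<open>For \<open>b = 0\<close> the restricted name is sent to \<open>R\<close>: a
        communication below the restriction becomes a scope extrusion by
        \<open>tr_CloseR\<close>.\<close>
      proof (cases b)
        case 0
        with tr_Open[of P a0 P1] 4(3) m have "tr (NewB P) (LBOut a0) P1" by simp
        from tr_CloseR[OF this] R0(1) m have "tr (Par (NewB P) R) LTau (NewB (Par P1 R0))" by simp
        then show ?thesis
          unfolding Z 4(2) l by (rule matchedI) (simp add: R0(3) m 0 inst_0_lift_Suc congr_refl)
      next
        case (Suc b0)
        with tr_New[of P "LOut a0 b0" P1] 4(3) m have "tr (NewB P) (LOut a0 b0) (NewB P1)" by simp
        from tr_CommR[OF this] R0(1) m
        have "tr (Par (NewB P) R) LTau (Par (NewB P1) (subst (inst b0) R0))" by simp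
        then show ?thesis
          unfolding Z 4(2) l
          by (rule matchedI) (simp add: R0(3) m Suc subst_inst congr_extr)
      qed
    next
      case (5 a P1 R1)
      obtain m R0 where R0: "tr R m R0" "LBOut a = lmap Suc m" "R1 = subst (under m Suc) R0"
        using tr_subst_Suc_inv[OF 5(4)] by metis
      then obtain a0 where m: "m = LBOut a0" "a = Suc a0" by (cases m) auto
      have l: "l = LTau" using 5(1) by simp
      have "tr (NewB P) (LIn a0) (NewB (subst flip P1))"
        using tr_New[of P "LIn a0" P1] 5(3) m by simp
      from tr_CloseL[OF this] R0(1) m
      have *: "tr (Par (NewB P) R) LTau (NewB (Par (NewB (subst flip P1)) R0))" by simp
      have "(NewB (NewB (Par (subst flip P1) (subst Suc R0))), NewB (Par (NewB (subst flip P1)) R0)) \<in> congr S"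
        by (intro congr_new congr_extr)
      from congr_trans[OF congr_swap[of "Par P1 R1"]] this show ?thesis
        unfolding Z 5(2) l using * by (auto intro: matchedI simp: R0(3) m flip_lift_Suc)
    next
      case (6 a P1 R1)
      obtain m R0 where R0: "tr R m R0" "LIn a = lmap Suc m" "R1 = subst (under m Suc) R0"
        using tr_subst_Suc_inv[OF 6(4)] by metis
      then obtain a0 where m: "m = LIn a0" "a = Suc a0" by (cases m) auto
      have l: "l = LTau" using 6(1) by simp
      have "tr (NewB P) (LBOut a0) (NewB (subst flip P1))"
        using tr_New[of P "LBOut a0" P1] 6(3) m by simp
      from tr_CloseR[OF this] R0(1) m
      have *: "tr (Par (NewB P) R) LTau (NewB (Par (NewB (subst flip P1)) R0))" by simp
      have "(NewB (NewB (Par (subst flip P1) (subst Suc R0))), NewB (Par (NewB (subst flip P1)) R0)) \<in> congr S"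
        by (intro congr_new congr_extr)
      from congr_trans[OF congr_swap[of "Par P1 R1"]] this show ?thesis
        unfolding Z 6(2) l using * by (auto intro: matchedI simp: R0(3) m flip_lift_Suc)
    qed
  qed
qed

text \<open>The braid relation for the adjacent transpositions of indices 0, 1 and 1, 2. It arises
  when a binding transition passes two restrictions that are exchanged.\<close>

lemma flip_braid:
  "subst flip (subst (lift flip) (subst flip P)) = subst (lift flip) (subst flip (subst (lift flip) P))"
  unfolding subst_subst comp_assoc
proof (rule subst_cong)
  fix x
  show "(flip \<circ> (lift flip \<circ> flip)) x = (lift flip \<circ> (flip \<circ> lift flip)) x"
  proof (cases x rule: nat_cases3)
    case (3 y)
    then show ?thesis by (cases y) auto
  qed auto
qed

lemma tr_flip:
  assumes "tr P (lmap Suc (lmap Suc l)) P'"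
  shows "tr (subst flip P) (lmap Suc (lmap Suc l)) (subst (under l flip) P')"
  using tr_subst[OF assms, of flip] by (simp add: lmap_lmap comp_def)

text \<open>Opening the outer restriction on one side is opening the inner one on the other, with
  equal residuals. If neither is opened, the residuals are double restrictions that differ again by
  \<open>congr_swap\<close>.\<close>

lemma matches_swap: "matches UNIV S (NewB (NewB P)) (NewB (NewB (subst flip P)))"
proof (rule matchesI)
  fix l Z assume "tr (NewB (NewB P)) l Z"
  then show "matched S (NewB (NewB (subst flip P))) l Z"
  proof (cases rule: tr_NewE)
    case (1 a)
    note l = 1(1)
    from 1(2) show ?thesis
    proof (cases rule: tr_NewE)
      case (2 P1)
      from tr_subst[OF 2(2), of flip]
      have "tr (NewB (subst flip P)) (LBOut (Suc a)) (subst flip P1)"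
        by (auto intro: tr_Open)
      from tr_New[of _ "LBOut a", simplified, OF this] show ?thesis
        unfolding l 2(1) by (simp add: matched_refl)
    qed auto
  next
    case (2 P1)
    note Z = 2(1)
    from 2(2) show ?thesis
    proof (cases rule: tr_NewE)
      case (1 a)
      then obtain a0 where l: "l = LBOut a0" "a = Suc a0" by (cases l) auto
      from tr_subst[OF 1(2), of flip] l
      have "tr (NewB (subst flip P)) (LOut (Suc a0) 0) (NewB (subst flip P1))"
        using tr_New[of "subst flip P" "LOut (Suc a0) 0"] by simp
      from tr_Open[OF this] show ?thesis
        unfolding Z l(1) by (simp add: matched_refl)
    next
      case (2 P2)
      from tr_New[OF tr_New[OF tr_flip[OF 2(2)]]] show ?thesis
        unfolding Z 2(1)
      proof (rule matchedI)
        show "(NewB (exch l (NewB (exch (lmap Suc l) P2))),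
            NewB (exch l (NewB (exch (lmap Suc l) (subst (under l flip) P2))))) \<in> congr S"
          using congr_swap[of "subst (lift flip) (subst flip P2)" S] congr_swap[of P2 S]
          by (cases "binds l") (simp_all add: exch_def under_def flip_braid)
      qed
    qed
  qed
qed

section \<open>Transitivity and the operators preserve matching\<close>

lemma matches_trans:
  assumes "matches L S P Q" "matches L S Q R"
  shows "matches L S P R"
  using assms unfolding matches_def matched_def by (meson congr_trans)

lemma matches_new:
  assumes L: "- {LTau} \<subseteq> L" and PQ: "matches L S P Q"
  shows "matches L S (NewB P) (NewB Q)"
proof (rule matchesI)
  fix l Z assume l: "l \<in> L" and "tr (NewB P) l Z"
  from this(2) show "matched S (NewB Q) l Z"
  proof (cases rule: tr_NewE)
    case (1 a)
    then show ?thesis using L matched_Open[OF matchesD[OF PQ]] by auto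
  next
    case (2 P1)
    have "lmap Suc l \<in> L" using l L by (cases l) auto
    with 2 show ?thesis using matched_New[OF matchesD[OF PQ]] by auto
  qed
qed

text \<open>A silent step may be composed of visible steps of the components, but a visible step
  never needs a silent one. Any \<open>L\<close> containing all visible labels is thus closed under
  what the rules demand.\<close>

lemma matches_par:
  assumes L: "- {LTau} \<subseteq> L" and "matches L S P Q" "matches L S P' Q'"
    and "(P, Q) \<in> congr S" "(P', Q') \<in> congr S"
  shows "matches L S (Par P P') (Par Q Q')"
proof (rule matchesI)
  have vis: "LIn a \<in> L" "LOut a b \<in> L" "LBOut a \<in> L" for a b using L by auto
  note D = matchesD[OF assms(2)] matchesD[OF assms(3)]
  fix l Z assume l: "l \<in> L" and "tr (Par P P') l Z"
  from this(2) show "matched S (Par Q Q') l Z"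
    by (cases rule: tr_ParE)
      (use assms(4,5) l in \<open>auto intro!: matched_ParL matched_ParR D vis
        intro: matched_CommL[OF D(1)[OF vis(1)] D(2)[OF vis(2)]]
          matched_CommR[OF D(1)[OF vis(2)] D(2)[OF vis(1)]]
          matched_CloseL[OF D(1)[OF vis(1)] D(2)[OF vis(3)]]
          matched_CloseR[OF D(1)[OF vis(3)] D(2)[OF vis(1)]]\<close>)
qed

lemma matches_rep:
  assumes L: "- {LTau} \<subseteq> L" and GH: "matches L S (Gd G) (Gd H)" "(Gd G, Gd H) \<in> congr S"
  shows "matches L S (Bang G) (Bang H)"
proof -
  have vis: "LIn a \<in> L" "LOut a b \<in> L" "LBOut a \<in> L" for a b using L by auto
  have bang: "(Bang G, Bang H) \<in> congr S" using GH(2) by (rule congr_rep)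
  note D = matchesD[OF GH(1)]
  \<comment> \<open>The rule \<open>tr_Rep\<close> unfolds \<open>Bang G\<close> into a term that
    contains it, so both sources are treated together, by induction on the derivation of the
    transition.\<close>
  have "l \<in> L \<Longrightarrow> (Z = Bang G \<longrightarrow> matched S (Bang H) l Z') \<and>
    (Z = Par (Bang G) (Gd G) \<longrightarrow> matched S (Par (Bang H) (Gd H)) l Z')" if "tr Z l Z'" for Z l Z'
    using that
  proof (induction rule: tr.induct)
    case (tr_Rep G' l P')
    then show ?case by (auto intro: matched_Rep)
  next
    case (tr_ParL P l P' Q)
    then show ?case using GH(2) by (auto intro: matched_ParL)
  next
    case (tr_ParR Q l Q' P)
    then show ?case using bang by (auto intro: matched_ParR D)
  next
    case (tr_CommL P a P' Q b Q')
    then show ?case using vis by (auto intro!: matched_CommL[of S "Bang H" a P' "Gd H" b Q'] D)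
  next
    case (tr_CommR P a b P' Q Q')
    then show ?case using vis by (auto intro: matched_CommR[of S _ a b] D)
  next
    case (tr_CloseL P a P' Q Q')
    then show ?case using vis by (auto intro!: matched_CloseL[of S "Bang H" a P' "Gd H" Q'] D)
  next
    case (tr_CloseR P a P' Q Q')
    then show ?case using vis by (auto intro!: matched_CloseR[of S "Bang H" a P' "Gd H" Q'] D)
  qed auto
  then show ?thesis by (auto intro: matchesI)
qed

text \<open>The part common to both inductions. Only \<open>congr_base\<close> depends on whether
  silent labels are included, and it is left as a hypothesis. For an input prefix the late style
  pays off: the residuals are the related continuations themselves.\<close>

lemma congr_matches_if_base:
  assumes L: "- {LTau} \<subseteq> L"
    and base: "\<And>P Q \<sigma>. (P, Q) \<in> S \<Longrightarrow> matches L S (subst \<sigma> P) (subst \<sigma> Q)"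
  shows "(P, Q) \<in> congr S \<Longrightarrow> matches L S P Q"
proof (induction rule: congr.induct)
  case (congr_refl P)
  show ?case by (auto intro: matchesI matched_refl)
next
  case (congr_sum G H G' H')
  show ?case
  proof (rule matchesI)
    fix l Z assume "l \<in> L" "tr (Gd (Plus G G')) l Z"
    from this(2) this(1) show "matched S (Gd (Plus H H')) l Z"
      using congr_sum.IH
      by (cases rule: tr_PlusE) (auto simp: matches_def intro: matched_Sum)
  qed
next
  case (congr_tau P Q)
  then show ?case by (auto intro!: matchesI elim!: tr_TauE intro: matchedI tr_Tau)
next
  case (congr_out P Q)
  then show ?case by (auto intro!: matchesI elim!: tr_OutE intro: matchedI tr_Out)
next
  case (congr_inp P Q)
  then show ?case by (auto intro!: matchesI elim!: tr_InE intro: matchedI tr_In)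
next
  case (congr_swap P)
  show ?case by (rule matches_mono[OF matches_swap]) simp
next
  case (congr_comm P)
  show ?case by (rule matches_mono[OF matches_comm]) simp
next
  case (congr_extr P)
  show ?case by (rule matches_mono[OF matches_extr]) simp
next
  case (congr_intr P)
  show ?case by (rule matches_mono[OF matches_intr]) simp
qed (blast intro: base matches_trans matches_new[OF L] matches_par[OF L] matches_rep[OF L])+

section \<open>Transitions of substituted processes\<close>

lemma subst_eq_iffs:
  "subst \<sigma> P = Bang G \<longleftrightarrow> (\<exists>G'. P = Bang G' \<and> G = substG \<sigma> G')"
  "subst \<sigma> P = Par Q R \<longleftrightarrow> (\<exists>Q' R'. P = Par Q' R' \<and> Q = subst \<sigma> Q' \<and> R = subst \<sigma> R')"
  "subst \<sigma> P = NewB Q \<longleftrightarrow> (\<exists>Q'. P = NewB Q' \<and> Q = subst (lift \<sigma>) Q')"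
  "subst \<sigma> P = Gd G \<longleftrightarrow> (\<exists>G'. P = Gd G' \<and> G = substG \<sigma> G')"
  by (cases P; auto)+

lemma substG_eq_iffs:
  "substG \<sigma> G = Out a b P \<longleftrightarrow> (\<exists>a' b' P'. G = Out a' b' P' \<and> a = \<sigma> a' \<and> b = \<sigma> b' \<and> P = subst \<sigma> P')"
  "substG \<sigma> G = InB a P \<longleftrightarrow> (\<exists>a' P'. G = InB a' P' \<and> a = \<sigma> a' \<and> P = subst (lift \<sigma>) P')"
  "substG \<sigma> G = Tau P \<longleftrightarrow> (\<exists>P'. G = Tau P' \<and> P = subst \<sigma> P')"
  "substG \<sigma> G = Plus H K \<longleftrightarrow> (\<exists>H' K'. G = Plus H' K' \<and> H = substG \<sigma> H' \<and> K = substG \<sigma> K')"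
  by (cases G; auto)+

lemma lift_eq_Suc: "lift \<sigma> x = Suc y \<longleftrightarrow> (\<exists>z. x = Suc z \<and> \<sigma> z = y)"
  by (cases x) auto

lemma lift_eq_0: "lift \<sigma> x = 0 \<longleftrightarrow> x = 0"
  by (cases x) auto

lemma lmap_Suc_eq_lmap_lift:
  "lmap Suc l = lmap (lift \<sigma>) m \<Longrightarrow> \<exists>k. m = lmap Suc k \<and> l = lmap \<sigma> k"
proof (cases m)
  case (LOut a b)
  assume "lmap Suc l = lmap (lift \<sigma>) m"
  with LOut obtain a' b' where "a = Suc a'" "b = Suc b'" "l = LOut (\<sigma> a') (\<sigma> b')"
    by (cases l) (auto simp: lift_eq_Suc dest!: sym[of "Suc _"])
  with LOut show ?thesis by (intro exI[of _ "LOut a' b'"]) simp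
next
  case (LBOut a)
  assume "lmap Suc l = lmap (lift \<sigma>) m"
  with LBOut obtain a' where "a = Suc a'" "l = LBOut (\<sigma> a')"
    by (cases l) (auto simp: lift_eq_Suc dest!: sym[of "Suc _"])
  with LBOut show ?thesis by (intro exI[of _ "LBOut a'"]) simp
next
  case (LIn a)
  assume "lmap Suc l = lmap (lift \<sigma>) m"
  with LIn obtain a' where "a = Suc a'" "l = LIn (\<sigma> a')"
    by (cases l) (auto simp: lift_eq_Suc dest!: sym[of "Suc _"])
  with LIn show ?thesis by (intro exI[of _ "LIn a'"]) simp
next
  case LTau
  assume "lmap Suc l = lmap (lift \<sigma>) m"
  with LTau show ?thesis by (intro exI[of _ LTau]) simp
qed

text \<open>Channels are compared only in the rules that produce silent labels, so the derivation of
  a visible transition can be pulled back along \<open>\<sigma>\<close>. At \<open>tr_Open\<close>,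
  \<open>lift \<sigma>\<close> maps nothing but index 0 to 0, so the name extruded is the restricted
  one already before substitution.\<close>

lemma visible_subst_inv:
  "tr Z l Z' \<Longrightarrow> l \<noteq> LTau \<Longrightarrow> Z = subst \<sigma> P \<Longrightarrow>
    \<exists>m P'. tr P m P' \<and> l = lmap \<sigma> m \<and> Z' = subst (under m \<sigma>) P'"
proof (induction arbitrary: \<sigma> P rule: tr.induct)
  case (tr_In a Q)
  then obtain a' P' where "P = Gd (InB a' P')" "a = \<sigma> a'" "Q = subst (lift \<sigma>) P'"
    by (auto simp: eq_commute[of "Gd _"] eq_commute[of "InB _ _"] subst_eq_iffs substG_eq_iffs)
  then show ?case by (intro exI[of _ "LIn a'"] exI[of _ P']) (simp add: tr.tr_In)
next
  case (tr_Out a b Q)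
  then obtain a' b' P' where "P = Gd (Out a' b' P')" "a = \<sigma> a'" "b = \<sigma> b'" "Q = subst \<sigma> P'"
    by (auto simp: eq_commute[of "Gd _"] eq_commute[of "Out _ _ _"] subst_eq_iffs substG_eq_iffs)
  then show ?case by (intro exI[of _ "LOut a' b'"] exI[of _ P']) (simp add: tr.tr_Out)
next
  case (tr_Rep G l P')
  then obtain G' where G': "P = Bang G'" "G = substG \<sigma> G'"
    by (auto simp: eq_commute[of "Bang _"] subst_eq_iffs)
  with tr_Rep.IH[of \<sigma> "Par (Bang G') (Gd G')"] tr_Rep.prems show ?case
    by (auto intro: tr.tr_Rep)
next
  case (tr_SumL G l P' H)
  then obtain G' H' where G': "P = Gd (Plus G' H')" "G = substG \<sigma> G'"
    by (auto simp: eq_commute[of "Gd _"] eq_commute[of "Plus _ _"] subst_eq_iffs substG_eq_iffs)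
  with tr_SumL.IH[of \<sigma> "Gd G'"] tr_SumL.prems show ?case
    by (auto intro: tr.tr_SumL)
next
  case (tr_SumR G l P' H)
  then obtain G' H' where G': "P = Gd (Plus H' G')" "G = substG \<sigma> G'"
    by (auto simp: eq_commute[of "Gd _"] eq_commute[of "Plus _ _"] subst_eq_iffs substG_eq_iffs)
  with tr_SumR.IH[of \<sigma> "Gd G'"] tr_SumR.prems show ?case
    by (auto intro: tr.tr_SumR)
next
  case (tr_Open Q a Q')
  then obtain P1 where P1: "P = NewB P1" "Q = subst (lift \<sigma>) P1"
    by (auto simp: eq_commute[of "NewB _"] subst_eq_iffs)
  from tr_Open.IH[OF _ P1(2)] obtain m P' where m: "tr P1 m P'" "LOut (Suc a) 0 = lmap (lift \<sigma>) m"
    "Q' = subst (under m (lift \<sigma>)) P'" by auto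
  then obtain a' where a': "m = LOut (Suc a') 0" "\<sigma> a' = a"
    by (cases m) (auto simp: lift_eq_Suc lift_eq_0 eq_commute[of "Suc _"] eq_commute[of 0])
  with m have "tr P (LBOut a') P'" by (auto simp: P1 intro: tr.tr_Open)
  with m a' show ?case by (intro exI conjI) auto
next
  case (tr_New Q l Q')
  then obtain P1 where P1: "P = NewB P1" "Q = subst (lift \<sigma>) P1"
    by (auto simp: eq_commute[of "NewB _"] subst_eq_iffs)
  from tr_New.IH[OF _ P1(2)] tr_New.prems obtain m P' where m: "tr P1 m P'"
    "lmap Suc l = lmap (lift \<sigma>) m" "Q' = subst (under m (lift \<sigma>)) P'" by auto
  then obtain k where k: "m = lmap Suc k" "l = lmap \<sigma> k"
    using lmap_Suc_eq_lmap_lift by blast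
  with m have "tr P k (NewB (exch k P'))" by (auto simp: P1 intro: tr.tr_New)
  moreover have "NewB (exch l Q') = subst (under k \<sigma>) (NewB (exch k P'))"
    using exch_subst[of k \<sigma> P'] m(3) k by (simp add: exch_def)
  ultimately show ?case using k(2) by blast
next
  case (tr_ParL Q l Q' R)
  then obtain P1 P2 where P1: "P = Par P1 P2" "Q = subst \<sigma> P1" "R = subst \<sigma> P2"
    by (auto simp: eq_commute[of "Par _ _"] subst_eq_iffs)
  from tr_ParL.IH[OF _ P1(2)] tr_ParL.prems obtain m P' where m: "tr P1 m P'"
    "l = lmap \<sigma> m" "Q' = subst (under m \<sigma>) P'" by auto
  from tr.tr_ParL[OF m(1), of P2] m(2,3) show ?case
    by (intro exI[of _ m] exI[of _ "Par P' (weak m P2)"]) (simp add: P1 weak_subst)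
next
  case (tr_ParR Q l Q' R)
  then obtain P1 P2 where P1: "P = Par P2 P1" "Q = subst \<sigma> P1" "R = subst \<sigma> P2"
    by (auto simp: eq_commute[of "Par _ _"] subst_eq_iffs)
  from tr_ParR.IH[OF _ P1(2)] tr_ParR.prems obtain m P' where m: "tr P1 m P'"
    "l = lmap \<sigma> m" "Q' = subst (under m \<sigma>) P'" by auto
  from tr.tr_ParR[OF m(1), of P2] m(2,3) show ?case
    by (intro exI[of _ m] exI[of _ "Par (weak m P2) P'"]) (simp add: P1 weak_subst)
qed auto

lemma lmap_eq_iffs:
  "LOut a b = lmap \<sigma> m \<longleftrightarrow> (\<exists>c d. m = LOut c d \<and> a = \<sigma> c \<and> b = \<sigma> d)"
  "LBOut a = lmap \<sigma> m \<longleftrightarrow> (\<exists>c. m = LBOut c \<and> a = \<sigma> c)"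
  "LIn a = lmap \<sigma> m \<longleftrightarrow> (\<exists>c. m = LIn c \<and> a = \<sigma> c)"
  by (cases m; auto)+

lemma LIn_subst_inv:
  "tr (subst \<sigma> P) (LIn a) Z \<Longrightarrow> \<exists>c P'. tr P (LIn c) P' \<and> a = \<sigma> c \<and> Z = subst (lift \<sigma>) P'"
  by (drule visible_subst_inv[OF _ _ refl]) (fastforce simp: lmap_eq_iffs)+

lemma LBOut_subst_inv:
  "tr (subst \<sigma> P) (LBOut a) Z \<Longrightarrow> \<exists>c P'. tr P (LBOut c) P' \<and> a = \<sigma> c \<and> Z = subst (lift \<sigma>) P'"
  by (drule visible_subst_inv[OF _ _ refl]) (fastforce simp: lmap_eq_iffs)+

lemma LOut_subst_inv:
  "tr (subst \<sigma> P) (LOut a b) Z \<Longrightarrow>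
    \<exists>c d P'. tr P (LOut c d) P' \<and> a = \<sigma> c \<and> b = \<sigma> d \<and> Z = subst \<sigma> P'"
  by (drule visible_subst_inv[OF _ _ refl]) (fastforce simp: lmap_eq_iffs)+

text \<open>Clause \<open>bound\<close> can only hold up to \<open>congr\<close>: going through a bound output moves the extruded
  restriction outermost.  The condition \<open>a \<noteq> c\<close> ensures that neither channel is restricted.\<close>

inductive tau_origin :: "proc rel \<Rightarrow> (name \<Rightarrow> name) \<Rightarrow> proc \<Rightarrow> proc \<Rightarrow> bool" for S \<sigma> P where
  tau: "tr P LTau P' \<Longrightarrow> tau_origin S \<sigma> P (subst \<sigma> P')"
| free: "tr P (LOut a b) P1 \<Longrightarrow> tr P1 (LIn c) P2 \<Longrightarrow> a \<noteq> c \<Longrightarrow> \<sigma> a = \<sigma> c \<Longrightarrow>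
    tau_origin S \<sigma> P (subst \<sigma> (subst (inst b) P2))"
| bound: "tr P (LBOut a) P1 \<Longrightarrow> tr P1 (LIn (Suc c)) P2 \<Longrightarrow> a \<noteq> c \<Longrightarrow> \<sigma> a = \<sigma> c \<Longrightarrow>
    (Z, NewB (subst (lift \<sigma>) (subst (inst 0) P2))) \<in> congr S \<Longrightarrow> tau_origin S \<sigma> P Z"

lemma tau_origin_mono:
  assumes "\<And>l P'. tr P l P' \<Longrightarrow> tr Q l P'"
  shows "tau_origin S \<sigma> P Z \<Longrightarrow> tau_origin S \<sigma> Q Z"
  by (erule tau_origin.cases) (auto intro: tau_origin.intros dest: assms)

lemma tau_origin_NewB:
  assumes "tau_origin S (lift \<sigma>) P Z"
  shows "tau_origin S \<sigma> (NewB P) (NewB Z)"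
  using assms
proof cases
  case (tau P')
  with tau_origin.tau[OF tr_New[where l = LTau]] show ?thesis by fastforce
next
  case (free a b P1 c P2)
  from free(4,5) obtain a0 c0 where ac: "a = Suc a0" "c = Suc c0" "a0 \<noteq> c0" "\<sigma> a0 = \<sigma> c0"
    by (cases a; cases c) auto
  show ?thesis
  proof (cases b)
    case 0
    \<comment> \<open>Restricting the very name that is sent turns a free origin into a bound
      one.\<close>
    have "tr (NewB P) (LBOut a0) P1" using free(2) by (auto simp: ac 0 intro: tr_Open)
    from tau_origin.bound[OF this free(3)[unfolded ac] ac(3,4) congr_refl] show ?thesis
      by (simp add: free(1) 0)
  next
    case (Suc b0)
    have "tr (NewB P) (LOut a0 b0) (NewB P1)" "tr (NewB P1) (LIn c0) (NewB (subst flip P2))"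
      using tr_New[of P "LOut a0 b0"] tr_New[of P1 "LIn c0"] free(2,3) by (auto simp: ac Suc)
    from tau_origin.free[OF this ac(3,4)] show ?thesis
      unfolding inst_NewB free(1) Suc by simp
  qed
next
  case (bound a P1 c P2)
  from bound(3,4) obtain a0 c0 where ac: "a = Suc a0" "c = Suc c0" "a0 \<noteq> c0" "\<sigma> a0 = \<sigma> c0"
    by (cases a; cases c) auto
  have out: "tr (NewB P) (LBOut a0) (NewB (subst flip P1))"
    using tr_New[of P "LBOut a0"] bound(1) by (simp add: ac)
  have inp: "tr (NewB (subst flip P1)) (LIn (Suc c0)) (NewB (subst flip (subst (lift flip) P2)))"
    using tr_New[of "subst flip P1" "LIn (Suc c0)"] tr_subst[OF bound(2), of flip] by (simp add: ac)
  have "subst flip (subst (inst 0) P2) = subst (inst (Suc 0)) (subst (lift flip) P2)"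
    by (auto simp: subst_subst intro!: subst_eqI)
  \<comment> \<open>The added restriction lies outside the extruded one, which has to be outermost:
    hence the exchange.\<close>
  moreover have "(NewB Z, NewB (NewB (subst (lift (lift \<sigma>)) (subst flip (subst (inst 0) P2))))) \<in> congr S"
    using congr_trans[OF congr_new[OF bound(5)[unfolded subst.simps]] congr_swap]
    by (simp add: flip_lift_lift)
  ultimately show ?thesis
    by (intro tau_origin.bound[OF out inp ac(3,4)]) (unfold inst_NewB, simp)
qed

lemma tau_origin_ParL:
  assumes "tau_origin S \<sigma> P Z"
  shows "tau_origin S \<sigma> (Par P R) (Par Z (subst \<sigma> R))"
  using assms
proof cases
  case (tau P')
  with tau_origin.tau[OF tr_ParL[where l = LTau]] show ?thesis by fastforce
next
  case (free a b P1 c P2)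
  have "tr (Par P R) (LOut a b) (Par P1 R)" "tr (Par P1 R) (LIn c) (Par P2 (subst Suc R))"
    using tr_ParL[OF free(2), of R] tr_ParL[OF free(3), of R] by auto
  from tau_origin.free[OF this free(4,5)] show ?thesis
    by (simp add: free(1) inst_Suc)
next
  case (bound a P1 c P2)
  have "tr (Par P R) (LBOut a) (Par P1 (subst Suc R))"
    "tr (Par P1 (subst Suc R)) (LIn (Suc c)) (Par P2 (subst Suc (subst Suc R)))"
    using tr_ParL[OF bound(1), of R] tr_ParL[OF bound(2), of "subst Suc R"] by auto
  from tau_origin.bound[OF this bound(3,4)] show ?thesis
    using congr_trans[OF congr_par[OF bound(5) congr_refl] congr_intr]
    by (simp add: inst_Suc subst_lift_Suc)
qed

lemma tau_origin_ParR:
  assumes "tau_origin S \<sigma> P Z"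
  shows "tau_origin S \<sigma> (Par R P) (Par (subst \<sigma> R) Z)"
  using assms
proof cases
  case (tau P')
  with tau_origin.tau[OF tr_ParR[where l = LTau]] show ?thesis by fastforce
next
  case (free a b P1 c P2)
  have "tr (Par R P) (LOut a b) (Par R P1)" "tr (Par R P1) (LIn c) (Par (subst Suc R) P2)"
    using tr_ParR[OF free(2), of R] tr_ParR[OF free(3), of R] by auto
  from tau_origin.free[OF this free(4,5)] show ?thesis
    by (simp add: free(1) inst_Suc)
next
  case (bound a P1 c P2)
  have 1: "tr (Par R P) (LBOut a) (Par (subst Suc R) P1)"
    "tr (Par (subst Suc R) P1) (LIn (Suc c)) (Par (subst Suc (subst Suc R)) P2)"
    using tr_ParR[OF bound(1), of R] tr_ParR[OF bound(2), of "subst Suc R"] by auto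
  let ?P2 = "subst (lift \<sigma>) (subst (inst 0) P2)"
  have "(Par (subst \<sigma> R) Z, Par (NewB ?P2) (subst \<sigma> R)) \<in> congr S"
    by (rule congr_trans[OF congr_comm congr_par[OF bound(5) congr_refl]])
  from congr_trans[OF this congr_intr]
  have "(Par (subst \<sigma> R) Z, NewB (Par (subst Suc (subst \<sigma> R)) ?P2)) \<in> congr S"
    by (rule congr_trans) (intro congr_new congr_comm)
  then show ?thesis
    using tau_origin.bound[OF 1 bound(3,4), of "Par (subst \<sigma> R) Z" S]
    by (simp add: inst_Suc subst_lift_Suc)
qed

text \<open>If the two channels of a communication coincide before \<open>\<sigma>\<close>, it is a
  silent step of \<open>P\<close>. If not, it can be interleaved, the sender moving before the
  receiver; the lemmas above carry this pair of steps out through the surrounding context.\<close>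

lemma tau_subst_inv:
  "tr Z l Z' \<Longrightarrow> l = LTau \<Longrightarrow> Z = subst \<sigma> P \<Longrightarrow> tau_origin S \<sigma> P Z'"
proof (induction arbitrary: \<sigma> P rule: tr.induct)
  case (tr_Tau Q)
  then show ?case
    by (auto simp: eq_commute[of "Gd _"] eq_commute[of "Tau _"] subst_eq_iffs substG_eq_iffs
        intro!: tau tr.tr_Tau)
next
  case (tr_Rep G l P')
  then obtain G' where G': "P = Bang G'" "G = substG \<sigma> G'"
    by (auto simp: eq_commute[of "Bang _"] subst_eq_iffs)
  with tr_Rep.IH[of \<sigma> "Par (Bang G') (Gd G')"] tr_Rep.prems show ?case
    by (auto intro: tau_origin_mono[rotated] tr.tr_Rep)
next
  case (tr_SumL G l P' H)
  then obtain G' H' where G': "P = Gd (Plus G' H')" "G = substG \<sigma> G'"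
    by (auto simp: eq_commute[of "Gd _"] eq_commute[of "Plus _ _"] subst_eq_iffs substG_eq_iffs)
  with tr_SumL.IH[of \<sigma> "Gd G'"] tr_SumL.prems show ?case
    by (auto intro: tau_origin_mono[rotated] tr.tr_SumL)
next
  case (tr_SumR G l P' H)
  then obtain G' H' where G': "P = Gd (Plus H' G')" "G = substG \<sigma> G'"
    by (auto simp: eq_commute[of "Gd _"] eq_commute[of "Plus _ _"] subst_eq_iffs substG_eq_iffs)
  with tr_SumR.IH[of \<sigma> "Gd G'"] tr_SumR.prems show ?case
    by (auto intro: tau_origin_mono[rotated] tr.tr_SumR)
next
  case (tr_New Q l Q')
  then obtain P1 where P1: "P = NewB P1" "Q = subst (lift \<sigma>) P1"
    by (auto simp: eq_commute[of "NewB _"] subst_eq_iffs)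
  with tr_New show ?case by (auto intro: tau_origin_NewB)
next
  case (tr_ParL Q l Q' R)
  then obtain P1 P2 where P1: "P = Par P1 P2" "Q = subst \<sigma> P1" "R = subst \<sigma> P2"
    by (auto simp: eq_commute[of "Par _ _"] subst_eq_iffs)
  with tr_ParL show ?case by (auto intro: tau_origin_ParL)
next
  case (tr_ParR Q l Q' R)
  then obtain P1 P2 where P1: "P = Par P2 P1" "Q = subst \<sigma> P1" "R = subst \<sigma> P2"
    by (auto simp: eq_commute[of "Par _ _"] subst_eq_iffs)
  with tr_ParR show ?case by (auto intro: tau_origin_ParR)
next
  case (tr_CommL Q a Q' R b R')
  then obtain P1 P2 where P: "P = Par P1 P2" "Q = subst \<sigma> P1" "R = subst \<sigma> P2"
    by (auto simp: eq_commute[of "Par _ _"] subst_eq_iffs)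
  obtain c P1' where c: "tr P1 (LIn c) P1'" "a = \<sigma> c" "Q' = subst (lift \<sigma>) P1'"
    using LIn_subst_inv tr_CommL.hyps(1) P(2) by blast
  obtain d e P2' where d: "tr P2 (LOut d e) P2'" "a = \<sigma> d" "b = \<sigma> e" "R' = subst \<sigma> P2'"
    using LOut_subst_inv tr_CommL.hyps(2) P(3) by blast
  have Z: "Par (subst (inst b) Q') R' = subst \<sigma> (Par (subst (inst e) P1') P2')"
    by (simp add: c d subst_inst)
  show ?case
  proof (cases "c = d")
    case True
    from tau[OF tr.tr_CommL[OF c(1)]] d(1) show ?thesis by (simp only: Z P True)
  next
    case False
    have "tr P (LOut d e) (Par P1 P2')" "tr (Par P1 P2') (LIn c) (Par P1' (subst Suc P2'))"
      using tr.tr_ParR[OF d(1), of P1] tr.tr_ParL[OF c(1), of P2'] by (auto simp: P)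
    from free[OF this, of \<sigma> S] False c d show ?thesis by (simp add: Z[simplified] inst_Suc subst_inst)
  qed
next
  case (tr_CommR Q a b Q' R R')
  then obtain P1 P2 where P: "P = Par P1 P2" "Q = subst \<sigma> P1" "R = subst \<sigma> P2"
    by (auto simp: eq_commute[of "Par _ _"] subst_eq_iffs)
  obtain c P2' where c: "tr P2 (LIn c) P2'" "a = \<sigma> c" "R' = subst (lift \<sigma>) P2'"
    using LIn_subst_inv tr_CommR.hyps(2) P(3) by blast
  obtain d e P1' where d: "tr P1 (LOut d e) P1'" "a = \<sigma> d" "b = \<sigma> e" "Q' = subst \<sigma> P1'"
    using LOut_subst_inv tr_CommR.hyps(1) P(2) by blast
  have Z: "Par Q' (subst (inst b) R') = subst \<sigma> (Par P1' (subst (inst e) P2'))"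
    by (simp add: c d subst_inst)
  show ?case
  proof (cases "c = d")
    case True
    from tau[OF tr.tr_CommR[OF d(1)]] c(1) show ?thesis by (simp only: Z P True)
  next
    case False
    have "tr P (LOut d e) (Par P1' P2)" "tr (Par P1' P2) (LIn c) (Par (subst Suc P1') P2')"
      using tr.tr_ParL[OF d(1), of P2] tr.tr_ParR[OF c(1), of P1'] by (auto simp: P)
    from free[OF this, of \<sigma> S] False c d show ?thesis by (simp add: Z[simplified] inst_Suc subst_inst)
  qed
next
  case (tr_CloseL Q a Q' R R')
  then obtain P1 P2 where P: "P = Par P1 P2" "Q = subst \<sigma> P1" "R = subst \<sigma> P2"
    by (auto simp: eq_commute[of "Par _ _"] subst_eq_iffs)
  obtain c P1' where c: "tr P1 (LIn c) P1'" "a = \<sigma> c" "Q' = subst (lift \<sigma>) P1'"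
    using LIn_subst_inv tr_CloseL.hyps(1) P(2) by blast
  obtain d P2' where d: "tr P2 (LBOut d) P2'" "a = \<sigma> d" "R' = subst (lift \<sigma>) P2'"
    using LBOut_subst_inv tr_CloseL.hyps(2) P(3) by blast
  have Z: "NewB (Par Q' R') = subst \<sigma> (NewB (Par P1' P2'))"
    by (simp add: c d)
  show ?case
  proof (cases "c = d")
    case True
    from tau[OF tr.tr_CloseL[OF c(1)]] d(1) show ?thesis by (simp only: Z P True)
  next
    case False
    \<comment> \<open>The receiver idles during the output and is shifted, so its channel becomes
      \<open>Suc c\<close>. Instantiating the input with index 0 makes it receive the extruded
      name.\<close>
    have "tr P (LBOut d) (Par (subst Suc P1) P2')"
      "tr (Par (subst Suc P1) P2') (LIn (Suc c)) (Par (subst (lift Suc) P1') (subst Suc P2'))"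
      using tr.tr_ParR[OF d(1), of P1] tr.tr_ParL[OF tr_subst[OF c(1), of Suc], of P2'] by (auto simp: P)
    from bound[OF this, of \<sigma> "NewB (Par Q' R')" S] False c d show ?thesis
      by (simp add: inst_Suc inst_0_lift_Suc congr_refl)
  qed
next
  case (tr_CloseR Q a Q' R R')
  then obtain P1 P2 where P: "P = Par P1 P2" "Q = subst \<sigma> P1" "R = subst \<sigma> P2"
    by (auto simp: eq_commute[of "Par _ _"] subst_eq_iffs)
  obtain c P2' where c: "tr P2 (LIn c) P2'" "a = \<sigma> c" "R' = subst (lift \<sigma>) P2'"
    using LIn_subst_inv tr_CloseR.hyps(2) P(3) by blast
  obtain d P1' where d: "tr P1 (LBOut d) P1'" "a = \<sigma> d" "Q' = subst (lift \<sigma>) P1'"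
    using LBOut_subst_inv tr_CloseR.hyps(1) P(2) by blast
  have Z: "NewB (Par Q' R') = subst \<sigma> (NewB (Par P1' P2'))"
    by (simp add: c d)
  show ?case
  proof (cases "c = d")
    case True
    from tau[OF tr.tr_CloseR[OF d(1)]] c(1) show ?thesis by (simp only: Z P True)
  next
    case False
    have "tr P (LBOut d) (Par P1' (subst Suc P2))"
      "tr (Par P1' (subst Suc P2)) (LIn (Suc c)) (Par (subst Suc P1') (subst (lift Suc) P2'))"
      using tr.tr_ParL[OF d(1), of P2] tr.tr_ParR[OF tr_subst[OF c(1), of Suc], of P1'] by (auto simp: P)
    from bound[OF this, of \<sigma> "NewB (Par Q' R')" S] False c d show ?thesis
      by (simp add: inst_Suc inst_0_lift_Suc congr_refl)
  qed
qed auto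

section \<open>Aliased communication and soundness\<close>

lemma calculusD:
  assumes "calculus C" "P \<in> C"
  shows "P \<longmapsto>[\<mu>] P' \<Longrightarrow> P' \<in> C" and "subst \<sigma> P \<in> C"
  using assms by (auto simp: calculus_def)

lemma aliased_free:
  assumes ac: "aliased_communication C" and "P \<in> C"
    and tr: "tr P (LOut a b) P1" "tr P1 (LIn c) P2" and \<sigma>: "\<sigma> a = \<sigma> c"
  shows "tr (subst \<sigma> P) LTau (subst \<sigma> (subst (inst b) P2))"
proof -
  have "P \<longmapsto>[AOut a b] P1" "P1 \<longmapsto>[AIn c b] subst (inst b) P2"
    using tr by (auto simp: lts_iff_tr subst_id)
  then have "subst \<sigma> P \<longmapsto>[ATau] subst \<sigma> (subst (inst b) P2)"
    using ac \<open>P \<in> C\<close> \<sigma> unfolding aliased_communication_def by blast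
  then show ?thesis by (auto simp: lts_iff_tr subst_id)
qed

lemma aliased_bound:
  assumes ac: "aliased_communication C" and "P \<in> C"
    and tr: "tr P (LBOut a) P1" "tr P1 (LIn (Suc c)) P2" and \<sigma>: "\<sigma> a = \<sigma> c"
  shows "tr (subst \<sigma> P) LTau (NewB (subst (lift \<sigma>) (subst (inst 0) P2)))"
proof -
  obtain b where b: "b \<notin> fn P" "b \<notin> \<sigma> ` fn P"
    using fresh_name[of "fn P \<union> \<sigma> ` fn P"] finite_fn by blast
  \<comment> \<open>The property wants a substitution that fixes \<open>b\<close> and sends no other
    name to \<open>b\<close>, which \<open>\<sigma>\<close> may violate outside \<open>fn P\<close>.
    Only the values on \<open>fn P\<close> matter, and \<open>Suc b\<close> is just some name other
    than \<open>b\<close>.\<close>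
  define \<tau> where "\<tau> x = (if x = b then b else if x \<in> fn P then \<sigma> x else Suc b)" for x
  let ?P' = "subst (inst b) (subst (lift (inst b)) P2)"
  have fn1: "a \<in> fn P" "fn P1 \<subseteq> insert 0 (Suc ` fn P)"
    using tr_fn[OF tr(1)] by auto
  have fn2: "c \<in> fn P" "fn P2 \<subseteq> insert 0 (Suc ` insert 0 (Suc ` fn P))"
    using tr_fn[OF tr(2)] fn1(2) by (auto dest!: subset_trans[OF _ insert_mono[OF image_mono[OF fn1(2)]]])
  have "P \<longmapsto>[ABOut a b] subst (inst b) P1"
    using tr(1) b by (auto simp: lts_iff_tr)
  moreover have "subst (inst b) P1 \<longmapsto>[AIn c b] ?P'"
    using tr_subst[OF tr(2), of "inst b"] by (auto simp: lts_iff_tr)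
  moreover have "\<tau> a = \<tau> c" "\<tau> b = b" "\<forall>x. \<tau> x = b \<longrightarrow> x = b"
    using b fn1 fn2 \<sigma> by (auto simp: \<tau>_def)
  ultimately have "subst \<tau> P \<longmapsto>[ATau] res b (subst \<tau> ?P')"
    using ac \<open>P \<in> C\<close> unfolding aliased_communication_def by blast
  moreover have "subst \<tau> P = subst \<sigma> P"
    by (rule subst_cong) (use b in \<open>auto simp: \<tau>_def\<close>)
  moreover have "close b (subst \<tau> ?P') = subst (lift \<sigma>) (subst (inst 0) P2)"
    unfolding close_def subst_subst
  proof (rule subst_cong)
    fix x assume "x \<in> fn P2"
    with fn2(2) consider "x = 0" | "x = Suc 0" | y where "x = Suc (Suc y)" "y \<in> fn P" by auto
    then show "((\<lambda>x. if x = b then 0 else Suc x) \<circ> (\<tau> \<circ> (inst b \<circ> lift (inst b)))) x =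
        (lift \<sigma> \<circ> inst 0) x"
      by cases (use b in \<open>auto simp: \<tau>_def\<close>)
  qed
  ultimately show ?thesis by (simp add: res_def lts_iff_tr subst_id)
qed

lemma matches_visible_subst:
  assumes "matches UNIV S P Q"
  shows "matches (- {LTau}) S (subst \<sigma> P) (subst \<sigma> Q)"
proof (rule matchesI)
  fix l Z assume "l \<in> - {LTau}" "tr (subst \<sigma> P) l Z"
  then obtain m P' where m: "tr P m P'" "l = lmap \<sigma> m" "Z = subst (under m \<sigma>) P'"
    using visible_subst_inv by blast
  from matchesD[OF assms _ m(1)] obtain Q' where "tr Q m Q'" "(P', Q') \<in> congr S"
    by (auto simp: matched_def)
  with m show "matched S (subst \<sigma> Q) l Z"
    by (auto intro: matchedI tr_subst congr_subst)
qed

lemma congr_matches: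
  assumes C: "aliased_communication C" "\<And>P Q. (P, Q) \<in> S \<Longrightarrow> Q \<in> C"
    and S: "\<And>P Q. (P, Q) \<in> S \<Longrightarrow> matches UNIV S P Q"
    and PQ: "(P, Q) \<in> congr S"
  shows "matches UNIV S P Q"
proof -
  have vis: "matches (- {LTau}) S P Q" if "(P, Q) \<in> congr S" for P Q
    by (rule congr_matches_if_base[OF _ _ that]) (auto intro: matches_visible_subst S)
  show ?thesis
  proof (rule congr_matches_if_base[OF _ _ PQ])
    fix P Q \<sigma> assume PQ: "(P, Q) \<in> S"
    note step = matchesD[OF S[OF PQ]]
    have "Q \<in> C" using C PQ by blast
    show "matches UNIV S (subst \<sigma> P) (subst \<sigma> Q)"
    proof (rule matchesI)
      fix l Z assume Z: "tr (subst \<sigma> P) l Z"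
      show "matched S (subst \<sigma> Q) l Z"
      proof (cases "l = LTau")
        case False
        with matches_visible_subst[OF S[OF PQ], of \<sigma>] Z show ?thesis by (auto dest: matchesD)
      next
        case True
        with Z have "tau_origin S \<sigma> P Z" by (blast intro: tau_subst_inv)
        then show ?thesis
        proof cases
          case (tau P')
          with step[of LTau P'] True show ?thesis
            by (fastforce simp: matched_def dest: tr_subst[of Q LTau _ \<sigma>] intro: congr_subst)
        next
          case (free a b P1 c P2)
          from step[OF _ free(2)] obtain Q1 where Q1: "tr Q (LOut a b) Q1" "(P1, Q1) \<in> congr S"
            by (auto simp: matched_def)
          \<comment> \<open>\<open>P1\<close> and \<open>Q1\<close> are related by
            \<open>congr S\<close> and need not be in \<open>S\<close>, so \<open>step\<close> no
            longer applies and \<open>vis\<close> takes over.\<close>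
          from matchesD[OF vis[OF Q1(2)] _ free(3)] obtain Q2 where
            Q2: "tr Q1 (LIn c) Q2" "(P2, Q2) \<in> congr S" by (auto simp: matched_def)
          from aliased_free[OF C(1) \<open>Q \<in> C\<close> Q1(1) Q2(1) free(5)] show ?thesis
            unfolding True free(1) by (rule matchedI) (intro congr_subst Q2)
        next
          case (bound a P1 c P2)
          from step[OF _ bound(1)] obtain Q1 where Q1: "tr Q (LBOut a) Q1" "(P1, Q1) \<in> congr S"
            by (auto simp: matched_def)
          from matchesD[OF vis[OF Q1(2)] _ bound(2)] obtain Q2 where
            Q2: "tr Q1 (LIn (Suc c)) Q2" "(P2, Q2) \<in> congr S" by (auto simp: matched_def)
          from aliased_bound[OF C(1) \<open>Q \<in> C\<close> Q1(1) Q2(1) bound(4)] show ?thesis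
            unfolding True
            by (rule matchedI) (rule congr_trans[OF bound(5)], intro congr_new congr_subst Q2)
        qed
      qed
    qed
  qed auto
qed

section \<open>From early simulation to matching and back\<close>

lemma sim_imp_matches:
  assumes "(P, Q) \<in> sim C X" "X \<subseteq> congr S"
  shows "matches UNIV S P Q"
proof (rule matchesI)
  fix l P' assume tr: "tr P l P'"
  obtain c where c: "c \<notin> fn P" "c \<notin> fn Q"
    using fresh_name[of "fn P \<union> fn Q"] finite_fn by blast
  define \<mu> where "\<mu> = (case l of LOut a b \<Rightarrow> AOut a b | LBOut a \<Rightarrow> ABOut a c | LIn a \<Rightarrow> AIn a c | LTau \<Rightarrow> ATau)"
  have \<mu>: "lab_of \<mu> = l" "bn \<mu> \<inter> fn P = {}" "bn \<mu> \<inter> fn Q = {}" "sub_of \<mu> = (if binds l then inst c else id)"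
    using c by (auto simp: \<mu>_def split: lab.split)
  have "P \<longmapsto>[\<mu>] subst (sub_of \<mu>) P'" using tr \<mu> by (auto simp: lts_iff_tr)
  then obtain Z where "Q \<longmapsto>[\<mu>] Z" "(subst (sub_of \<mu>) P', Z) \<in> congr S"
    using assms \<mu>(3) unfolding sim_def by blast
  then obtain Q' where Q': "tr Q l Q'" "(subst (sub_of \<mu>) P', subst (sub_of \<mu>) Q') \<in> congr S"
    using \<mu>(1) by (auto simp: lts_iff_tr)
  have "(P', Q') \<in> congr S"
  proof (cases "binds l")
    case True
    \<comment> \<open>Turning \<open>c\<close> back into index 0 is a substitution, under which
      \<open>congr S\<close> is closed; it recovers both late targets because \<open>c\<close> is
      fresh for both sources.\<close>
    from congr_subst[OF Q'(2), of "\<lambda>x. if x = c then 0 else Suc x"]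
    have "(close c (subst (inst c) P'), close c (subst (inst c) Q')) \<in> congr S"
      using \<mu>(4) True by (simp add: close_def)
    then show ?thesis using close_inst[OF tr True c(1)] close_inst[OF Q'(1) True c(2)] by simp
  next
    case False
    with Q'(2) \<mu>(4) show ?thesis by (simp add: subst_id)
  qed
  with Q'(1) show "matched S Q l P'" by (rule matchedI)
qed

text \<open>Matching ignores \<open>C\<close>, but \<open>C\<close> is closed under transitions, so
  the residuals are in \<open>C\<close> again.\<close>

lemma matches_imp_sim:
  assumes C: "calculus C" "P \<in> C" "Q \<in> C" and PQ: "matches UNIV S P Q"
  shows "(P, Q) \<in> sim C (congr S \<inter> C \<times> C)"
proof -
  have "\<exists>Z. Q \<longmapsto>[\<mu>] Z \<and> (P', Z) \<in> congr S \<inter> C \<times> C"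
    if "P \<longmapsto>[\<mu>] P'" "bn \<mu> \<inter> fn Q = {}" for \<mu> P'
  proof -
    from that(1) obtain P0 where P0: "tr P (lab_of \<mu>) P0" "P' = subst (sub_of \<mu>) P0"
      by (auto simp: lts_iff_tr)
    from matchesD[OF PQ _ P0(1)] obtain Q0 where Q0: "tr Q (lab_of \<mu>) Q0" "(P0, Q0) \<in> congr S"
      by (auto simp: matched_def)
    then have "Q \<longmapsto>[\<mu>] subst (sub_of \<mu>) Q0" using that(2) by (auto simp: lts_iff_tr)
    moreover from this that(1) C have "subst (sub_of \<mu>) Q0 \<in> C" "P' \<in> C"
      using calculusD(1) by blast+
    ultimately show ?thesis using Q0(2) P0(2) by (auto intro: congr_subst)
  qed
  with C show ?thesis by (simp add: sim_def)
qed

section \<open>The up-to functions are absorbed by the congruence\<close>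

lemma congr_res: "(P, Q) \<in> congr S \<Longrightarrow> (res a P, res a Q) \<in> congr S"
  by (simp add: res_def close_def congr_new congr_subst)

lemma congr_foldr_res: "(P, Q) \<in> congr S \<Longrightarrow> (foldr res as P, foldr res as Q) \<in> congr S"
  by (induction as) (auto intro: congr_res)

lemma congr_baseI: "(P, Q) \<in> S \<Longrightarrow> (P, Q) \<in> congr S"
  using congr_base[of P Q S id] by (simp add: subst_id)

lemma up_step_congr:
  assumes "bisimilarity C \<subseteq> congr S" "X \<subseteq> congr S"
  shows "up_step C X \<subseteq> congr S"
proof -
  have "up_bisim C X \<subseteq> congr S"
    using assms unfolding up_bisim_def by (blast intro: congr_trans)
  moreover have "up_refl X \<subseteq> congr S" by (auto simp: up_refl_def congr_refl)
  moreover have "up_sub X \<subseteq> congr S" using assms by (auto simp: up_sub_def intro: congr_subst)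
  moreover have "up_res X \<subseteq> congr S" using assms by (auto simp: up_res_def intro: congr_foldr_res)
  moreover have "up_pcomp X \<subseteq> congr S" using assms by (auto simp: up_pcomp_def intro: congr_par)
  moreover have "up_sum X \<subseteq> congr S" using assms by (auto simp: up_sum_def intro: congr_sum)
  moreover have "up_rep X \<subseteq> congr S" using assms by (auto simp: up_rep_def intro: congr_rep)
  moreover have "up_tau X \<subseteq> congr S" using assms by (auto simp: up_tau_def intro: congr_tau)
  moreover have "up_out X \<subseteq> congr S" using assms by (auto simp: up_out_def intro: congr_out)
  moreover have "up_inp X \<subseteq> congr S"
    using assms by (auto simp: up_inp_def inp_def close_def intro: congr_inp congr_subst)
  ultimately show ?thesis using assms unfolding up_step_def by blast
qed

lemma omega_up_step_congr:
  assumes "bisimilarity C \<subseteq> congr S" "R \<subseteq> congr S"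
  shows "omega (up_step C) R \<subseteq> congr S"
proof -
  have "(up_step C ^^ n) R \<subseteq> congr S" for n
    by (induction n) (use assms up_step_congr in simp_all)
  then show ?thesis by (auto simp: omega_def)
qed

lemma sim_mono: "X \<subseteq> Y \<Longrightarrow> sim C X \<subseteq> sim C Y"
  by (fastforce simp: sim_def)

lemma bis_mono:
  assumes "X \<subseteq> Y"
  shows "bis C X \<subseteq> bis C Y"
proof -
  have "X\<inverse> \<subseteq> Y\<inverse>" using assms by auto
  from sim_mono[OF this, of C] sim_mono[OF assms, of C] show ?thesis unfolding bis_def by blast
qed

lemma bisimilarity_subset_bis: "bisimilarity C \<subseteq> bis C (bisimilarity C)"
proof
  fix p assume "p \<in> bisimilarity C"
  then obtain R where R: "p \<in> R" "R \<subseteq> C \<times> C" "R \<subseteq> bis C R" by (auto simp: bisimilarity_def)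
  have "R \<subseteq> bisimilarity C" using R(2,3) unfolding bisimilarity_def by blast
  from bis_mono[OF this] R show "p \<in> bis C (bisimilarity C)" by blast
qed

theorem theorem29:
  fixes C :: "proc set"
  assumes "calculus C"
    and "aliased_communication C"
  shows "sound_on C (bbar C) (omega (up_step C))"
proof -
  define S where "S R = (R \<union> bisimilarity C) \<union> (R \<union> bisimilarity C)\<inverse>" for R
  have bC: "bisimilarity C \<subseteq> C \<times> C" by (auto simp: bisimilarity_def)
  show ?thesis
    unfolding sound_on_def
  \<comment> \<open>The witness extends every \<open>R\<close>, whether or not \<open>R\<close>
    progresses. The intersection discards the contexts that leave \<open>C\<close>.\<close>
  proof (intro exI[of _ "\<lambda>R. congr (S R) \<inter> C \<times> C"] conjI allI impI)
    fix R :: "proc rel" assume "R \<subseteq> C \<times> C"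
    then show "R \<subseteq> congr (S R) \<inter> C \<times> C" by (auto simp: S_def intro: congr_baseI)
  next
    fix R :: "proc rel" assume RC: "R \<subseteq> C \<times> C" and R: "R \<subseteq> bbar C (omega (up_step C) R)"
    have SC: "S R \<subseteq> C \<times> C" using RC bC by (auto simp: S_def)
    have sym: "sym (S R)" by (auto simp: S_def sym_def)
    have base: "bisimilarity C \<subseteq> congr (S R)" "R \<subseteq> congr (S R)"
      by (auto simp: S_def intro: congr_baseI)
    have conv: "(congr (S R))\<inverse> = congr (S R)"
      using congr_sym[OF sym] by auto
    have bis: "R \<union> bisimilarity C \<subseteq> bis C (congr (S R))"
    proof -
      \<comment> \<open>Here the assumed progress of \<open>R\<close> enters: all iterates of the
        up-to functions stay inside \<open>congr (S R)\<close>.\<close>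
      have "R \<subseteq> bis C (congr (S R))"
        using R bis_mono[OF omega_up_step_congr[OF base]] unfolding bbar_def by blast
      then show ?thesis using bisimilarity_subset_bis bis_mono[OF base(1)] by blast
    qed
    have "matches UNIV (S R) P Q" if "(P, Q) \<in> S R" for P Q
    proof -
      from that bis have "(P, Q) \<in> sim C (congr (S R))"
        unfolding S_def bis_def conv[unfolded S_def] by blast
      then show ?thesis by (rule sim_imp_matches) simp
    qed
    then have "matches UNIV (S R) P Q" if "(P, Q) \<in> congr (S R)" for P Q
      using congr_matches[OF assms(2), of "S R"] SC that by blast
    then have sim: "(P, Q) \<in> sim C (congr (S R) \<inter> C \<times> C)" if "(P, Q) \<in> congr (S R) \<inter> C \<times> C" for P Q
      using that matches_imp_sim[OF assms(1)] by blast
    have conv': "(congr (S R) \<inter> C \<times> C)\<inverse> = congr (S R) \<inter> C \<times> C"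
      using congr_sym[OF sym] by auto
    show "congr (S R) \<inter> C \<times> C \<subseteq> bbar C (congr (S R) \<inter> C \<times> C)"
    proof
      fix p assume p: "p \<in> congr (S R) \<inter> C \<times> C"
      obtain P Q where PQ: "p = (P, Q)" by fastforce
      have "(Q, P) \<in> congr (S R) \<inter> C \<times> C" using p conv' PQ by blast
      with p[unfolded PQ] sim show "p \<in> bbar C (congr (S R) \<inter> C \<times> C)"
        unfolding PQ bbar_def bis_def conv' by blast
    qed
  qed simp
qed

end
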